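(* Fix an o-minimal structure expanding the real field, with respect to which definability is understood. Let $U\subset\mathbf{R}^n$ be a bounded definable set and $f\colon U\to\mathbf{R}$ a definable function. Then there exist a concave definable desingularizer $\phi$ and a constant $\rho>0$ such that $$|\nabla(\phi\circ f)|(x)\ \ge\ 1\qquad\text{whenever } x\in U \text{ and } 0<f(x)<\rho .$$
   Context: $U$ is regarded as a metric space with the Euclidean metric $d$ inherited from $\mathbf{R}^n$. Slope: for a metric space $(X,d)$, a function $g\colon X\to[-\infty,+\infty]$ and a point $x$ with $g(x)$ finite, $|\nabla g|(x)$ is the infimum of those $\epsilon>0$ for which $x$ is a local minimizer of $y\mapsto g(y)+\epsilon\,d(x,y)$ (with $\inf\emptyset=+\infty$). A desingularizer is a continuous function $\phi\colon[0,\infty)\to[0,\infty)$ with $\phi(0)=0$ that has a continuous, strictly positive derivative on $(0,+\infty)$. To make sense of $\phi\circ f$ where $f<0$, set $\phi(t)=0$ for $t<0$. *)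

theory Defs
  imports "HOL-Analysis.Analysis"
begin

text \<open>
  Points of $\mathbf{R}^n$ are real lists of length $n$: an o-minimal structure relates
  sets in all dimensions at once, so the dimension has to be a term and not a type.
\<close>

definition Rn :: "nat \<Rightarrow> real list set" where
  "Rn n = {xs. length xs = n}"

definition euclidean_dist :: "nat \<Rightarrow> real list \<Rightarrow> real list \<Rightarrow> real" where
  "euclidean_dist n xs ys = L2_set (\<lambda>i. xs ! i - ys ! i) {..<n}"

lemma Metric_space_euclidean_dist: "Metric_space (Rn n) (euclidean_dist n)"
proof
  fix x y z :: "real list"
  show "0 \<le> euclidean_dist n x y"
    by (simp add: euclidean_dist_def)
  show "euclidean_dist n x y = euclidean_dist n y x"
    by (simp add: euclidean_dist_def L2_set_def power2_commute)
  show "(euclidean_dist n x y = 0) = (x = y)" if "x \<in> Rn n" "y \<in> Rn n"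
    using that by (auto simp: euclidean_dist_def Rn_def L2_set_eq_0_iff list_eq_iff_nth_eq)
  have "(\<lambda>i. x ! i - z ! i) = (\<lambda>i. (x ! i - y ! i) + (y ! i - z ! i))"
    by auto
  then show "euclidean_dist n x z \<le> euclidean_dist n x y + euclidean_dist n y z"
    unfolding euclidean_dist_def by (metis L2_set_triangle_ineq)
qed

text \<open>
  Structures are given, following van den Dries, by their definable sets: \<open>S n\<close> is the
  collection of definable subsets of $\mathbf{R}^n$.
\<close>

locale real_structure =
  fixes S :: "nat \<Rightarrow> real list set set"
  assumes subset_Rn: "A \<in> S n \<Longrightarrow> A \<subseteq> Rn n"
    and empty: "{} \<in> S n"
    and Un: "A \<in> S n \<Longrightarrow> B \<in> S n \<Longrightarrow> A \<union> B \<in> S n"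
    and Compl: "A \<in> S n \<Longrightarrow> Rn n - A \<in> S n"
    and times_left: "A \<in> S n \<Longrightarrow> {t # xs | t xs. xs \<in> A} \<in> S (Suc n)"
    and times_right: "A \<in> S n \<Longrightarrow> {xs @ [t] | xs t. xs \<in> A} \<in> S (Suc n)"
    and diagonal: "{xs \<in> Rn (Suc n). xs ! 0 = xs ! n} \<in> S (Suc n)"
    and projection: "A \<in> S (Suc n) \<Longrightarrow> butlast ` A \<in> S n"

text \<open>
  Every finite union of intervals and points is required to be definable, so definability
  is with arbitrary real parameters. The library's \<open>is_interval\<close> covers bounded and unbounded,
  open, half-open and closed intervals, single points and the empty set.
\<close>

locale o_minimal_structure = real_structure +
  assumes less: "{[x, y] | x y. x < y} \<in> S 2"
    and o_minimal:
      "A \<in> S 1 \<longleftrightarrow> (\<exists>F. finite F \<and> (\<forall>I\<in>F. is_interval (I :: real set)) \<and> A = (\<lambda>t. [t]) ` \<Union>F)"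

locale o_minimal_real_field_expansion = o_minimal_structure +
  assumes add: "{[x, y, x + y] | x y. True} \<in> S 3"
    and mult: "{[x, y, x * y] | x y. True} \<in> S 3"

definition definable_fun ::
    "(nat \<Rightarrow> real list set set) \<Rightarrow> nat \<Rightarrow> real list set \<Rightarrow> (real list \<Rightarrow> real) \<Rightarrow> bool" where
  "definable_fun S n U f \<longleftrightarrow> {xs @ [f xs] | xs. xs \<in> U} \<in> S (Suc n)"

definition local_minimizer ::
    "'a set \<Rightarrow> ('a \<Rightarrow> 'a \<Rightarrow> real) \<Rightarrow> ('a \<Rightarrow> ereal) \<Rightarrow> 'a \<Rightarrow> bool" where
  "local_minimizer X d h x \<longleftrightarrow> x \<in> X \<and> (\<exists>r>0. \<forall>y\<in>X. d x y < r \<longrightarrow> h x \<le> h y)"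

text \<open>Only meaningful at points \<open>x\<close> of the metric space \<open>(X, d)\<close> at which \<open>g\<close> is finite.\<close>

definition slope ::
    "'a set \<Rightarrow> ('a \<Rightarrow> 'a \<Rightarrow> real) \<Rightarrow> ('a \<Rightarrow> ereal) \<Rightarrow> 'a \<Rightarrow> ereal" where
  "slope X d g x =
     Inf {ereal \<epsilon> | \<epsilon>. \<epsilon> > 0 \<and> local_minimizer X d (\<lambda>y. g y + ereal (\<epsilon> * d x y)) x}"

text \<open>
  A function on $[0,\infty)$ is represented by a total function of which only the values on
  \<open>{0..}\<close> matter.
\<close>

definition desingularizer :: "(real \<Rightarrow> real) \<Rightarrow> bool" where
  "desingularizer \<phi> \<longleftrightarrow>
     continuous_on {0..} \<phi> \<and> (\<forall>t\<ge>0. \<phi> t \<ge> 0) \<and> \<phi> 0 = 0 \<and>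
     (\<exists>\<phi>'. (\<forall>t>0. (\<phi> has_real_derivative \<phi>' t) (at t)) \<and>
           continuous_on {0<..} \<phi>' \<and> (\<forall>t>0. \<phi>' t > 0))"

definition definable_on_nonneg :: "(nat \<Rightarrow> real list set set) \<Rightarrow> (real \<Rightarrow> real) \<Rightarrow> bool" where
  "definable_on_nonneg S \<phi> \<longleftrightarrow> {[t, \<phi> t] | t. t \<ge> 0} \<in> S 2"

definition zero_ext :: "(real \<Rightarrow> real) \<Rightarrow> real \<Rightarrow> real" where
  "zero_ext \<phi> t = (if t < 0 then 0 else \<phi> t)"

end

theory Submission
  imports Defs
begin

text \<open>
  On each level \<open>f = t\<close> with small \<open>t > 0\<close>, definable choice selects a point \<open>x(t)\<close> at which the
  slope is minimal up to a factor 2. By o-minimality the coordinates of \<open>x(t)\<close> are monotone near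
  \<open>0\<close>, so a signed sum \<open>g\<close> of them controls the length of the curve, and \<open>g\<close> is bounded because
  \<open>U\<close> is. Since \<open>f(x(t)) = t\<close>, the slope at \<open>x(t)\<close> times \<open>g' t\<close> is at least \<open>1\<close>. Hence \<open>2 g\<close> is a
  definable desingularizer without any integration, up to an additive constant and a linear term.
  It is \<open>C\<^sup>1\<close> with monotone derivative near \<open>0\<close>: if the derivative decreases, it is concave;
  if it increases, it is bounded and a linear desingularizer does.
\<close>

section \<open>First-order definability\<close>

text \<open>The natural candidate for \<phi>' is the reciprocal of the smallest slope on each level,
  but an antiderivative of a definable function need not be definable. This is why a function
  \<open>g\<close> is sought that is definable from the start and whose derivative dominates that
  reciprocal. It exists because the L2 norm is at most the L1 norm, and the L1 length of a curve
  with monotone coordinates is a mere difference of endpoint values. The choice of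
  \<open>x(t)\<close> meets two obstacles: an infimum of slopes need not be attained, whence the
  factor 2, and it may a priori be zero, whence an escape clause for slopes at most t. That clause
  is refuted only at the end, because \<open>t * g' t\<close> tends to 0. Over the reals, the facts
  on monotonicity, continuity and differentiability can be proved for germs by a short route:
  uncountability of intervals takes the place of the usual combinatorial arguments.\<close>

context real_structure
begin

section \<open>Definable sets under intersection, padding, projection and coordinate maps\<close>

lemma Rn_definable: "Rn n \<in> S n"
  using Compl[OF empty] by simp

lemma Int_definable: "A \<inter> B \<in> S n" if "A \<in> S n" "B \<in> S n"
proof -
  have "A \<inter> B = Rn n - ((Rn n - A) \<union> (Rn n - B))"
    using subset_Rn[OF that(1)] by blast
  then show ?thesis using that by (simp add: Compl Un)
qed

lemma pad_left: "A \<in> S m \<Longrightarrow> {zs. length zs = k + m \<and> drop k zs \<in> A} \<in> S (k + m)"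
proof (induction k)
  case 0
  moreover have "{zs. length zs = m \<and> zs \<in> A} = A" using subset_Rn[OF 0] by (auto simp: Rn_def)
  ultimately show ?case by simp
next
  case (Suc k)
  have "{zs. length zs = Suc k + m \<and> drop (Suc k) zs \<in> A} =
      {t # zs | t zs. zs \<in> {zs. length zs = k + m \<and> drop k zs \<in> A}}"
    by (auto simp: length_Suc_conv)
  then show ?case using times_left[OF Suc.IH[OF Suc.prems]] by simp
qed

lemma pad_right: "A \<in> S m \<Longrightarrow> {zs. length zs = m + k \<and> take m zs \<in> A} \<in> S (m + k)"
proof (induction k)
  case 0
  moreover have "{zs. length zs = m \<and> take m zs \<in> A} = A" using subset_Rn[OF 0] by (auto simp: Rn_def)
  ultimately show ?case by simp
next
  case (Suc k)
  have "{zs. length zs = m + Suc k \<and> take m zs \<in> A} =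
      {zs @ [t] | zs t. zs \<in> {zs. length zs = m + k \<and> take m zs \<in> A}}"
    by (auto simp: length_Suc_conv_rev)
  then show ?case using times_right[OF Suc.IH[OF Suc.prems]] by simp
qed

lemma project_take: "A \<in> S (N + m) \<Longrightarrow> take N ` A \<in> S N"
proof (induction m arbitrary: A)
  case 0
  then have "take N ` A = A" using subset_Rn[OF 0] by (force simp: Rn_def)
  with 0 show ?case by simp
next
  case (Suc m)
  have "take N ` A = take N ` butlast ` A"
    using subset_Rn[OF Suc.prems] unfolding image_image Rn_def
    by (intro image_cong) (auto simp: butlast_conv_take)
  moreover have "butlast ` A \<in> S (N + m)"
    using projection Suc.prems by simp
  ultimately show ?case using Suc.IH by simp
qed

text \<open>The axiom \<open>diagonal\<close> equates only the first and the last coordinate.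
  Applied to the block of coordinates from i to j and padded on both sides, it gives any
  pair.\<close>

lemma coordinate_eq_less:
  assumes "i < j" "j < N"
  shows "{xs \<in> Rn N. xs ! i = xs ! j} \<in> S N"
proof -
  have "{zs. length zs = i + Suc (j - i) \<and> drop i zs \<in> {xs \<in> Rn (Suc (j - i)). xs ! 0 = xs ! (j - i)}}
      \<in> S (i + Suc (j - i))" (is "?E \<in> _")
    by (intro pad_left diagonal)
  then have "{zs. length zs = (i + Suc (j - i)) + (N - Suc j) \<and> take (i + Suc (j - i)) zs \<in> ?E}
      \<in> S ((i + Suc (j - i)) + (N - Suc j))"
    by (rule pad_right)
  also have "{zs. length zs = (i + Suc (j - i)) + (N - Suc j) \<and> take (i + Suc (j - i)) zs \<in> ?E}
      = {xs \<in> Rn N. xs ! i = xs ! j}"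
    using assms by (auto simp: Rn_def)
  finally show ?thesis using assms by simp
qed

lemma coordinate_eq:
  assumes "i < N" "j < N"
  shows "{xs \<in> Rn N. xs ! i = xs ! j} \<in> S N"
proof -
  consider "i < j" | "i = j" | "j < i" by linarith
  then show ?thesis
  proof cases
    case 3
    then have "{xs \<in> Rn N. xs ! j = xs ! i} \<in> S N" using coordinate_eq_less assms by blast
    then show ?thesis by (simp add: eq_commute)
  qed (use assms coordinate_eq_less Rn_definable in auto)
qed

lemma coordinate_pairs_eq:
  assumes "\<And>k. k < (m::nat) \<Longrightarrow> p k < N \<and> q k < N"
  shows "{xs \<in> Rn N. \<forall>k<m. xs ! p k = xs ! q k} \<in> S N"
  using assms
proof (induction m)
  case 0
  then show ?case using Rn_definable by simp
next
  case (Suc m)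
  have "{xs \<in> Rn N. \<forall>k<Suc m. xs ! p k = xs ! q k} =
    {xs \<in> Rn N. \<forall>k<m. xs ! p k = xs ! q k} \<inter> {xs \<in> Rn N. xs ! p m = xs ! q m}"
    by (auto simp: less_Suc_eq)
  then show ?case using Suc by (simp add: Int_definable coordinate_eq)
qed

text \<open>The graph of a coordinate map is cut out by diagonals, so a preimage arises by appending
  the selected coordinates, constraining the appended tail to A and projecting it away. As
  \<open>js\<close> may repeat, omit and permute indices, this covers all changes of
  variables.\<close>

lemma reindex:
  assumes A: "A \<in> S (length js)" and js: "set js \<subseteq> {..<N}"
  shows "{xs \<in> Rn N. map ((!) xs) js \<in> A} \<in> S N"
proof -
  let ?m = "length js"
  let ?C = "{zs. length zs = N + ?m \<and> drop N zs \<in> A} \<inter>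
    {zs \<in> Rn (N + ?m). \<forall>k<?m. zs ! (js ! k) = zs ! (N + k)}"
  have js': "k < ?m \<Longrightarrow> js ! k < N" for k using js nth_mem by blast
  have "{zs \<in> Rn (N + ?m). \<forall>k<?m. zs ! (js ! k) = zs ! (N + k)} \<in> S (N + ?m)"
    using js' by (intro coordinate_pairs_eq) (auto simp: trans_less_add1)
  then have "?C \<in> S (N + ?m)" by (intro Int_definable pad_left A)
  then have "take N ` ?C \<in> S N" by (rule project_take)
  moreover have "take N ` ?C = {xs \<in> Rn N. map ((!) xs) js \<in> A}" (is "_ = ?R")
  proof
    show "take N ` ?C \<subseteq> ?R"
    proof
      fix z assume "z \<in> take N ` ?C"
      then obtain zs where *: "z = take N zs" "length zs = N + ?m" "drop N zs \<in> A"
        "\<forall>k<?m. zs ! (js ! k) = zs ! (N + k)"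
        by auto
      have "map ((!) z) js = drop N zs"
        unfolding *(1) using *(2,4) js' by (intro nth_equalityI) auto
      then show "z \<in> ?R" using * by (simp add: Rn_def)
    qed
    show "?R \<subseteq> take N ` ?C"
    proof
      fix xs assume xs: "xs \<in> ?R"
      then have "xs @ map ((!) xs) js \<in> ?C"
        using js' by (auto simp: Rn_def nth_append)
      moreover have "xs = take N (xs @ map ((!) xs) js)" using xs by (auto simp: Rn_def)
      ultimately show "xs \<in> take N ` ?C" by blast
    qed
  qed
  ultimately show ?thesis by simp
qed

text \<open>Formulas are embedded shallowly, as predicates on infinite environments that depend on
  finitely many entries. Hiding N in the existential spares the connectives any bookkeeping of
  arities.\<close>

definition definable :: "((nat \<Rightarrow> real) \<Rightarrow> bool) \<Rightarrow> bool" where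
  "definable P \<longleftrightarrow> (\<exists>N. \<exists>A\<in>S N. \<forall>e. P e \<longleftrightarrow> map e [0..<N] \<in> A)"

lemma definable_reindex: "definable (\<lambda>e. map e js \<in> A)" if "A \<in> S (length js)"
proof -
  obtain N where N: "set js \<subseteq> {..<N}"
    using finite_nat_bounded[of "set js"] by auto
  have "map e js \<in> A \<longleftrightarrow> map e [0..<N] \<in> {xs \<in> Rn N. map ((!) xs) js \<in> A}" for e
  proof -
    have "map ((!) (map e [0..<N])) js = map e js" using N by auto
    then show ?thesis unfolding mem_Collect_eq by (simp only: Rn_def mem_Collect_eq length_map length_upt) simp
  qed
  then show ?thesis unfolding definable_def using reindex[OF that N] by blast
qed

lemma definable_rename:
  assumes "definable P"
  shows "definable (\<lambda>e. P (\<lambda>i. e (\<sigma> i)))"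
proof -
  obtain N A where A: "A \<in> S N" "\<And>e. P e \<longleftrightarrow> map e [0..<N] \<in> A"
    using assms unfolding definable_def by blast
  have "definable (\<lambda>e. map e (map \<sigma> [0..<N]) \<in> A)"
    using A by (intro definable_reindex) simp
  then show ?thesis by (simp add: A(2) comp_def)
qed

text \<open>Surplus variables are harmless, so two formulas can be brought to a common number of
  variables before their sets are intersected.\<close>

lemma definable_at:
  assumes "definable P"
  obtains M where "\<And>N. N \<ge> M \<Longrightarrow> \<exists>A\<in>S N. \<forall>e. P e \<longleftrightarrow> map e [0..<N] \<in> A"
proof -
  obtain M A where A: "A \<in> S M" "\<And>e. P e \<longleftrightarrow> map e [0..<M] \<in> A"
    using assms unfolding definable_def by blast
  have "\<exists>A\<in>S N. \<forall>e. P e \<longleftrightarrow> map e [0..<N] \<in> A" if N: "N \<ge> M" for N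
  proof -
    have "map ((!) (map e [0..<N])) [0..<M] = map e [0..<M]" for e :: "nat \<Rightarrow> real" using N by auto
    then have "\<forall>e. P e \<longleftrightarrow> map e [0..<N] \<in> {xs \<in> Rn N. map ((!) xs) [0..<M] \<in> A}"
      unfolding mem_Collect_eq by (simp add: Rn_def A(2) del: map_eq_conv)
    moreover have "{xs \<in> Rn N. map ((!) xs) [0..<M] \<in> A} \<in> S N"
      using A(1) N by (intro reindex) auto
    ultimately show ?thesis by blast
  qed
  then show ?thesis using that by blast
qed

lemma definable_conj:
  assumes "definable P" "definable Q"
  shows "definable (\<lambda>e. P e \<and> Q e)"
proof -
  obtain M1 where 1: "\<And>N. N \<ge> M1 \<Longrightarrow> \<exists>A\<in>S N. \<forall>e. P e \<longleftrightarrow> map e [0..<N] \<in> A"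
    using definable_at[OF assms(1)] by blast
  obtain M2 where 2: "\<And>N. N \<ge> M2 \<Longrightarrow> \<exists>A\<in>S N. \<forall>e. Q e \<longleftrightarrow> map e [0..<N] \<in> A"
    using definable_at[OF assms(2)] by blast
  let ?N = "max M1 M2"
  obtain A B where "A \<in> S ?N" "B \<in> S ?N" "\<forall>e. P e \<longleftrightarrow> map e [0..<?N] \<in> A"
     "\<forall>e. Q e \<longleftrightarrow> map e [0..<?N] \<in> B" using 1[of ?N] 2[of ?N] by auto
  then show ?thesis unfolding definable_def by (intro exI[of _ ?N] bexI[of _ "A \<inter> B"]) (auto intro: Int_definable)
qed

lemma definable_not:
  assumes "definable P"
  shows "definable (\<lambda>e. \<not> P e)"
proof -
  obtain N A where A: "A \<in> S N" "\<And>e. P e \<longleftrightarrow> map e [0..<N] \<in> A"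
    using assms unfolding definable_def by blast
  then have "\<forall>e. \<not> P e \<longleftrightarrow> map e [0..<N] \<in> Rn N - A" by (auto simp: Rn_def)
  then show ?thesis unfolding definable_def using Compl[OF A(1)] by blast
qed

lemma definable_disj: "definable (\<lambda>e. P e \<or> Q e)" if "definable P" "definable Q"
  using definable_not[OF definable_conj[OF that[THEN definable_not]]] by simp

lemma definable_imp: "definable (\<lambda>e. P e \<longrightarrow> Q e)" if "definable P" "definable Q"
  using definable_disj[OF definable_not[OF that(1)] that(2)] by simp

text \<open>Variables are counted as de Bruijn indices: under a quantifier, \<open>e 0\<close> is the bound
  variable and the remaining ones move up by one.\<close>

lemma definable_ex:
  assumes "definable (\<lambda>e. P (e 0) (\<lambda>i. e (Suc i)))"
  shows "definable (\<lambda>e. \<exists>t. P t e)"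
proof -
  obtain N A where A: "A \<in> S N" "\<And>e. P (e 0) (\<lambda>i. e (Suc i)) \<longleftrightarrow> map e [0..<N] \<in> A"
    using assms unfolding definable_def by blast
  \<comment> \<open>The bound variable has index 0, but \<open>projection\<close> forgets the last
    coordinate: variable 0 is read at position N, and variable \<open>Suc i\<close> at position
    i.\<close>
  let ?js = "map (case_nat N id) [0..<N]"
  let ?C = "{zs \<in> Rn (Suc N). map ((!) zs) ?js \<in> A}"
  have "?C \<in> S (Suc N)" using A(1) by (intro reindex) (auto split: nat.splits)
  then have C: "butlast ` ?C \<in> S N" by (rule projection)
  have P: "P t e \<longleftrightarrow> map e [0..<N] @ [t] \<in> ?C" for t e
  proof -
    have "P t e \<longleftrightarrow> map (case_nat t e) [0..<N] \<in> A" using A(2)[of "case_nat t e"] by simp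
    also have "map (case_nat t e) [0..<N] = map ((!) (map e [0..<N] @ [t])) ?js"
      by (auto simp: nth_append split: nat.splits)
    finally show ?thesis by (simp add: Rn_def)
  qed
  have "(\<exists>t. P t e) \<longleftrightarrow> map e [0..<N] \<in> butlast ` ?C" for e
  proof
    assume "\<exists>t. P t e"
    then obtain t where "map e [0..<N] @ [t] \<in> ?C" using P by blast
    then show "map e [0..<N] \<in> butlast ` ?C" by (intro image_eqI[where x="map e [0..<N] @ [t]"]) auto
  next
    assume "map e [0..<N] \<in> butlast ` ?C"
    then obtain zs where zs: "zs \<in> ?C" "map e [0..<N] = butlast zs" by blast
    then have "zs \<noteq> []" by (auto simp: Rn_def)
    then have "zs = map e [0..<N] @ [last zs]" using zs by simp
    then have "P (last zs) e" using zs(1) by (subst P) simp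
    then show "\<exists>t. P t e" by blast
  qed
  then show ?thesis unfolding definable_def using C by blast
qed

lemma definable_all: "definable (\<lambda>e. \<forall>t. P t e)" if "definable (\<lambda>e. P (e 0) (\<lambda>i. e (Suc i)))"
  using definable_not[OF definable_ex[OF definable_not[OF that]]] by simp

lemma definable_True: "definable (\<lambda>e. True)"
  unfolding definable_def by (intro exI[of _ 0] bexI[OF _ Rn_definable]) (simp add: Rn_def)

lemma definable_const: "definable (\<lambda>e. c)"
  using definable_True definable_not[OF definable_True] by (cases c) auto

section \<open>Definable functions as terms, and their substitution into formulas\<close>

definition definable_term :: "((nat \<Rightarrow> real) \<Rightarrow> real) \<Rightarrow> bool" where
  "definable_term u \<longleftrightarrow> definable (\<lambda>e. e 0 = u (\<lambda>i. e (Suc i)))"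

text \<open>A term is given only through its graph, so it is substituted by quantifying over its
  value. Any function with definable graph qualifies, including the derivatives, infima and choice
  functions below.\<close>

lemma definable_subst:
  assumes "definable (\<lambda>e. P (e 0) (\<lambda>i. e (Suc i)))" "definable_term u"
  shows "definable (\<lambda>e. P (u e) e)"
proof -
  have "definable (\<lambda>e. \<exists>t. t = u e \<and> P t e)"
    using assms unfolding definable_term_def by (intro definable_ex definable_conj)
  then show ?thesis by simp
qed

lemma definable_termI:
  assumes "\<And>t e. t = u e \<longleftrightarrow> R t e" "definable (\<lambda>e. R (e 0) (\<lambda>i. e (Suc i)))"
  shows "definable_term u"
  unfolding definable_term_def using assms by simp

lemma definable_term_graph:
  "definable (\<lambda>e. e k = u (\<lambda>i. e (\<sigma> i)))" if "definable_term u"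
  using definable_rename[OF that[unfolded definable_term_def], of "case_nat k \<sigma>"] by simp

lemma definable_term_rename: "definable_term u \<Longrightarrow> definable_term (\<lambda>e. u (\<lambda>i. e (\<sigma> i)))"
  by (rule definable_termI[where R="\<lambda>t e. t = u (\<lambda>i. e (\<sigma> i))"]) (auto intro: definable_term_graph)

text \<open>One use of \<open>definable_subst\<close> replaces one variable, so the terms are
  inserted one at a time; the variables from k on close the gap.\<close>

lemma definable_comp_aux:
  assumes "definable P" "\<And>i. definable_term (u i)"
  shows "definable (\<lambda>e. P (\<lambda>i. if i < k then u i e else e (i - k)))"
  using assms
proof (induction k arbitrary: P u)
  case 0
  then show ?case by simp
next
  case (Suc k)
  \<comment> \<open>Variable 0 of P is parked at position k, just past those filled by the induction
    hypothesis. It emerges as variable 0 and receives \<open>u 0\<close> last; the other terms are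
    shifted so as not to capture it.\<close>
  let ?Q = "\<lambda>x. P (\<lambda>i. case i of 0 \<Rightarrow> x k | Suc j \<Rightarrow> x (if j < k then j else Suc j))"
  have "definable (\<lambda>e. P (\<lambda>i. e (case i of 0 \<Rightarrow> k | Suc j \<Rightarrow> if j < k then j else Suc j)))"
    by (rule definable_rename) fact
  moreover have "(case i of 0 \<Rightarrow> x k | Suc j \<Rightarrow> x (if j < k then j else Suc j)) =
       x (case i of 0 \<Rightarrow> k | Suc j \<Rightarrow> if j < k then j else Suc j)" for x :: "nat \<Rightarrow> real" and i
    by (simp split: nat.splits)
  ultimately have "definable ?Q" by simp
  from Suc.IH[OF this, of "\<lambda>j e. u (Suc j) (\<lambda>i. e (Suc i))", OF definable_term_rename[OF Suc.prems(2)]]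
  have "definable (\<lambda>e. ?Q (\<lambda>i. if i < k then u (Suc i) (\<lambda>i. e (Suc i)) else e (i - k)))" .
  also have "(\<lambda>e. ?Q (\<lambda>i. if i < k then u (Suc i) (\<lambda>i. e (Suc i)) else e (i - k))) =
    (\<lambda>e. P (\<lambda>i. if i = 0 then e 0 else if i < Suc k then u i (\<lambda>i. e (Suc i)) else e (Suc (i - Suc k))))"
    by (intro ext arg_cong[of _ _ P]) (auto split: nat.splits simp: Suc_diff_le)
  finally have "definable (\<lambda>e. P (\<lambda>i. if i = 0 then e 0 else if i < Suc k then u i (\<lambda>i. e (Suc i)) else e (Suc (i - Suc k))))" .
  from definable_subst[where u="u 0" and P="\<lambda>t e. P (\<lambda>i. if i = 0 then t else if i < Suc k then u i e else e (i - Suc k))",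
      OF this Suc.prems(2)]
  have "definable (\<lambda>e. P (\<lambda>i. if i = 0 then u 0 e else if i < Suc k then u i e else e (i - Suc k)))" .
  also have "(\<lambda>e. P (\<lambda>i. if i = 0 then u 0 e else if i < Suc k then u i e else e (i - Suc k))) =
    (\<lambda>e. P (\<lambda>i. if i < Suc k then u i e else e (i - Suc k)))"
    by (intro ext arg_cong[of _ _ P]) auto
  finally show ?case .
qed

lemma definable_comp:
  assumes "definable P" "\<And>i. definable_term (u i)"
  shows "definable (\<lambda>e. P (\<lambda>i. u i e))"
proof -
  obtain N A where A: "A \<in> S N" "\<And>e. P e \<longleftrightarrow> map e [0..<N] \<in> A"
    using assms(1) unfolding definable_def by blast
  \<comment> \<open>P sees only its first N variables, so finitely many substitutions account for
    the whole family u.\<close>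
  have "P (\<lambda>i. if i < N then u i e else e (i - N)) = P (\<lambda>i. u i e)" for e
  proof -
    have "map (\<lambda>i. if i < N then u i e else e (i - N)) [0..<N] = map (\<lambda>i. u i e) [0..<N]"
      by (intro map_cong) auto
    then show ?thesis unfolding A(2) by (rule arg_cong)
  qed
  then show ?thesis using definable_comp_aux[where u=u and k=N, OF assms] by simp
qed

lemma definable_term_var: "definable_term (\<lambda>e. e k)"
proof -
  have "{xs \<in> Rn 2. xs ! 0 = xs ! 1} \<in> S 2" by (rule coordinate_eq_less) auto
  from definable_reindex[of _ "[0, Suc k]", simplified, OF this[simplified numeral_2_eq_2]]
  show ?thesis by (simp add: definable_term_def Rn_def)
qed

lemma definable_term_comp:
  assumes "definable_term w" "\<And>i. definable_term (u i)"
  shows "definable_term (\<lambda>e. w (\<lambda>i. u i e))"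
proof -
  let ?u = "\<lambda>i. case i of 0 \<Rightarrow> \<lambda>e. e 0 | Suc j \<Rightarrow> \<lambda>e. u j (\<lambda>i. e (Suc i))"
  have "definable_term (?u i)" for i
    using definable_term_var definable_term_rename[OF assms(2)] by (simp split: nat.splits)
  from definable_comp[where u="?u", OF assms(1)[unfolded definable_term_def] this]
  show ?thesis by (simp add: definable_term_def)
qed

lemma definable_comp1:
  "definable (\<lambda>e. P (u e))" if "definable (\<lambda>e. P (e 0))" "definable_term u"
  using definable_comp[OF that(1), of "\<lambda>i. u"] that(2) by simp

lemma definable_comp2:
  assumes "definable (\<lambda>e. P (e 0) (e (Suc 0)))" "definable_term u" "definable_term v"
  shows "definable (\<lambda>e. P (u e) (v e))"
  using definable_comp[OF assms(1), of "\<lambda>i. if i = 0 then u else v"] assms(2,3) by simp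

lemma definable_term_comp1:
  "definable_term (\<lambda>e. h (u e))" if "definable_term (\<lambda>e. h (e 0))" "definable_term u"
  using definable_term_comp[OF that(1), of "\<lambda>i. u"] that(2) by simp

lemma definable_term_comp2:
  assumes "definable_term (\<lambda>e. h (e 0) (e (Suc 0)))" "definable_term u" "definable_term v"
  shows "definable_term (\<lambda>e. h (u e) (v e))"
  using definable_term_comp[OF assms(1), of "\<lambda>i. if i = 0 then u else v"] assms(2,3) by simp

lemma definable_eq: "definable (\<lambda>e. u e = v e)" if "definable_term u" "definable_term v"
proof -
  have "definable (\<lambda>e. e 0 = e (Suc 0))"
    using definable_term_var[of 0] by (simp add: definable_term_def)
  from definable_comp2[where P="(=)", OF this that] show ?thesis .
qed

lemma definable_mem:
  "definable (\<lambda>e. map (\<lambda>i. u i e) [0..<n] \<in> A)" if "A \<in> S n" "\<And>i. definable_term (\<lambda>e. u i e)"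
  using definable_comp[OF definable_reindex[of A "[0..<n]"] that(2)] that(1) by simp

lemma definable_term_if:
  assumes "definable P" "definable_term u" "definable_term v"
  shows "definable_term (\<lambda>e. if P e then u e else v e)"
proof (rule definable_termI)
  show "t = (if P e then u e else v e) \<longleftrightarrow> (P e \<and> t = u e) \<or> (\<not> P e \<and> t = v e)" for t e
    by simp
  note * = definable_rename[OF assms(1), of Suc] definable_term_graph[OF assms(2), of 0 Suc]
    definable_term_graph[OF assms(3), of 0 Suc]
  show "definable (\<lambda>e. (P (\<lambda>i. e (Suc i)) \<and> e 0 = u (\<lambda>i. e (Suc i))) \<or>
      (\<not> P (\<lambda>i. e (Suc i)) \<and> e 0 = v (\<lambda>i. e (Suc i))))"
    by (intro definable_disj definable_conj definable_not *)
qed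

lemma definable_ex_vec:
  assumes "definable (\<lambda>e. P (map e [0..<n]) (\<lambda>i. e (i + n)))"
  shows "definable (\<lambda>e. \<exists>y\<in>Rn n. P y e)"
  using assms
proof (induction n arbitrary: P)
  case 0
  then show ?case by (simp add: Rn_def)
next
  case (Suc n)
  \<comment> \<open>The last coordinate of the vector is renamed to variable 0 and bound by a single
    quantifier; the induction hypothesis handles the others.\<close>
  have *: "map (\<lambda>i. e (if i < n then Suc i else if i = n then 0 else i)) [0..<n] =
      map (\<lambda>i. e (Suc i)) [0..<n]" for e :: "nat \<Rightarrow> real"
    by (intro map_cong) auto
  from definable_rename[OF Suc.prems, of "\<lambda>i. if i < n then Suc i else if i = n then 0 else i"]
  have "definable (\<lambda>e. P (map (\<lambda>i. e (Suc i)) [0..<n] @ [e 0]) (\<lambda>i. e (Suc (i + n))))"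
    by (simp add: *)
  then have "definable (\<lambda>e. \<exists>t. P (map e [0..<n] @ [t]) (\<lambda>i. e (i + n)))"
    by (intro definable_ex)
  from Suc.IH[OF this] have "definable (\<lambda>e. \<exists>y\<in>Rn n. \<exists>t. P (y @ [t]) e)" .
  moreover have "(\<exists>y\<in>Rn (Suc n). P y e) \<longleftrightarrow> (\<exists>y\<in>Rn n. \<exists>t. P (y @ [t]) e)" for e
    by (auto simp: Rn_def length_Suc_conv_rev)
  ultimately show ?case by simp
qed

lemma definable_all_vec:
  "definable (\<lambda>e. \<forall>y\<in>Rn n. P y e)" if "definable (\<lambda>e. P (map e [0..<n]) (\<lambda>i. e (i + n)))"
  using definable_not[OF definable_ex_vec[OF definable_not[OF that]]] by simp

end

section \<open>Order, constants and field operations\<close>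

context o_minimal_structure
begin

lemma definable_less: "definable (\<lambda>e. u e < v e)" if "definable_term u" "definable_term v"
proof -
  have "definable (\<lambda>e. e 0 < e (Suc 0))"
    using definable_reindex[of _ "[0, Suc 0]"] less by (force simp: numeral_2_eq_2)
  from definable_comp2[where P="(<)", OF this that] show ?thesis .
qed

lemma definable_le: "definable (\<lambda>e. u e \<le> v e)" if "definable_term u" "definable_term v"
  using definable_not[OF definable_less[OF that(2,1)]] by (simp add: not_less)

lemma definable_term_const: "definable_term (\<lambda>e. c)"
proof -
  have "(\<lambda>t. [t]) ` \<Union>{{c}} \<in> S 1"
    unfolding o_minimal by (intro exI[of _ "{{c}}"]) (auto simp: is_interval_1)
  from definable_reindex[of _ "[0]", simplified, OF this[simplified]]
  show ?thesis unfolding definable_term_def by simp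
qed

end

context o_minimal_real_field_expansion
begin

lemma definable_term_add: "definable_term (\<lambda>e. u e + v e)" if "definable_term u" "definable_term v"
proof (rule definable_term_comp2[where h="(+)", OF _ that])
  have "definable (\<lambda>e. map e [1, 2, 0] \<in> {[x, y, x + y] | x y. True})"
    by (rule definable_reindex) (use add in \<open>simp add: numeral_3_eq_3\<close>)
  then show "definable_term (\<lambda>e. e 0 + e (Suc 0))"
    by (simp add: definable_term_def numeral_2_eq_2)
qed

lemma definable_term_mult: "definable_term (\<lambda>e. u e * v e)" if "definable_term u" "definable_term v"
proof (rule definable_term_comp2[where h="(*)", OF _ that])
  have "definable (\<lambda>e. map e [1, 2, 0] \<in> {[x, y, x * y] | x y. True})"
    by (rule definable_reindex) (use mult in \<open>simp add: numeral_3_eq_3\<close>)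
  then show "definable_term (\<lambda>e. e 0 * e (Suc 0))"
    by (simp add: definable_term_def numeral_2_eq_2)
qed

lemma definable_term_uminus: "definable_term (\<lambda>e. - u e)" if "definable_term u"
  using definable_term_mult[OF definable_term_const[of "-1"] that] by simp

lemma definable_term_diff: "definable_term (\<lambda>e. u e - v e)" if "definable_term u" "definable_term v"
  using definable_term_add[OF that(1) definable_term_uminus[OF that(2)]] by simp

lemma definable_term_sum:
  "definable_term (\<lambda>e. \<Sum>i<n. u i e)" if "\<And>i. i < n \<Longrightarrow> definable_term (\<lambda>e. u i e)" for n :: nat
  using that by (induction n) (auto intro: definable_term_const definable_term_add)

lemmas definable_intros =
  definable_conj definable_disj definable_imp definable_not definable_ex definable_all definable_eq
  definable_less definable_le definable_ex_vec definable_all_vec definable_mem definable_term_var definable_term_const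
  definable_term_add definable_term_mult definable_term_uminus definable_term_diff

lemma definable_term_divide: "definable_term (\<lambda>e. u e / v e)" if "definable_term u" "definable_term v"
proof (rule definable_term_comp2[where h="(/)", OF _ that])
  \<comment> \<open>The graph has to include the convention \<open>x / 0 = 0\<close>.\<close>
  show "definable_term (\<lambda>e. e 0 / e (Suc 0))"
    by (rule definable_termI[where R="\<lambda>t e. (e (Suc 0) = 0 \<and> t = 0) \<or> (e (Suc 0) \<noteq> 0 \<and> t * e (Suc 0) = e 0)"])
      (auto simp: eq_divide_eq intro!: definable_intros split: if_splits)
qed

lemma definable_term_abs: "definable_term (\<lambda>e. \<bar>u e\<bar>)" if "definable_term u"
  using that by (simp only: abs_if, intro definable_term_if definable_intros)

lemma definable_term_sqrt: "definable_term (\<lambda>e. sqrt (u e))" if "definable_term u"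
proof (rule definable_term_comp1[where h="sqrt", OF _ that])
  \<comment> \<open>On negative arguments \<open>sqrt\<close> is the odd extension, whence the
    second disjunct.\<close>
  have "t = sqrt x \<longleftrightarrow> (x \<ge> 0 \<and> t \<ge> 0 \<and> t * t = x) \<or> (x < 0 \<and> t < 0 \<and> t * t = - x)" for t x
  proof (cases "x \<ge> 0")
    case True
    then show ?thesis by (auto simp: real_sqrt_unique power2_eq_square)
  next
    case False
    have "t = sqrt x \<longleftrightarrow> - t = sqrt (- x)" by (simp add: real_sqrt_minus)
    also have "\<dots> \<longleftrightarrow> - t > 0 \<and> t * t = - x"
    proof
      assume t: "- t = sqrt (- x)"
      then have "(- t) * (- t) = - x" using False by (metis less_eq_real_def neg_0_le_iff_le not_le real_sqrt_mult_self abs_of_nonneg)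
      moreover have "- t > 0" unfolding t using False by simp
      ultimately show "- t > 0 \<and> t * t = - x" by simp
    next
      assume "- t > 0 \<and> t * t = - x"
      then show "- t = sqrt (- x)" using real_sqrt_unique[of "- t" "- x"] by (simp add: power2_eq_square)
    qed
    finally show ?thesis using False by auto
  qed
  then show "definable_term (\<lambda>e. sqrt (e 0))"
    by (rule definable_termI) (auto intro!: definable_intros)
qed

end

section \<open>Germs of definable functions of one variable\<close>

lemma real_interval_induct:
  fixes a b :: real
  assumes "a \<le> b" and init: "P a"
    and left: "\<And>s. a < s \<Longrightarrow> s \<le> b \<Longrightarrow> (\<And>w. a \<le> w \<Longrightarrow> w < s \<Longrightarrow> P w) \<Longrightarrow> P s"
    and right: "\<And>s. a \<le> s \<Longrightarrow> s < b \<Longrightarrow> P s \<Longrightarrow> eventually P (at_right s)"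
  shows "P b"
proof -
  \<comment> \<open>The supremum of the initial segments on which P holds satisfies P by
    \<open>left\<close>, and by \<open>right\<close> it cannot lie below b.\<close>
  let ?T = "{z. a \<le> z \<and> z \<le> b \<and> (\<forall>w. a \<le> w \<longrightarrow> w \<le> z \<longrightarrow> P w)}"
  define s where "s = Sup ?T"
  have aT: "a \<in> ?T" using assms(1) init by auto
  have bdd: "bdd_above ?T" by (intro bdd_aboveI[of _ b]) auto
  have s1: "a \<le> s" unfolding s_def using aT bdd by (rule cSup_upper)
  have s2: "s \<le> b" unfolding s_def by (rule cSup_least) (use aT in blast, simp)
  note s = s1 s2
  have below: "P w" if w: "a \<le> w" "w < s" for w
  proof -
    have "\<exists>z\<in>?T. w < z" using w(2) aT bdd unfolding s_def by (subst (asm) less_cSup_iff) blast+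
    then obtain z where "z \<in> ?T" "w < z" by blast
    then show ?thesis using w(1) by simp
  qed
  have Ps: "P s" using left[OF _ s(2) below] init s(1) by (cases "a = s") auto
  show ?thesis
  proof (cases "s = b")
    case False
    with s have "s < b" by simp
    from right[OF s(1) this Ps] obtain u where u: "u > s" "\<And>y. s < y \<Longrightarrow> y < u \<Longrightarrow> P y"
      unfolding eventually_at_right_field by blast
    obtain v where v: "s < v" "v \<le> b" "v < u"
      using dense[of s "min b u"] u(1) \<open>s < b\<close> by auto
    have "P w" if "a \<le> w" "w \<le> v" for w
      using that v below[of w] Ps u(2)[of w] by (cases w s rule: linorder_cases) auto
    then have "v \<in> ?T" using v s by simp
    then have "v \<le> s" unfolding s_def by (intro cSup_upper bdd)
    with v show ?thesis by simp
  qed (use Ps in simp)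
qed

text \<open>Real induction on the right endpoint: the condition on the left of s carries the
  inequality into s, the condition on the right carries it past s.\<close>

lemma locally_mono_imp_mono_on:
  fixes h :: "real \<Rightarrow> real"
  assumes "\<And>x. x \<in> {a<..<b} \<Longrightarrow> \<forall>\<^sub>F y in at_right x. h x \<le> h y"
    and "\<And>x. x \<in> {a<..<b} \<Longrightarrow> \<forall>\<^sub>F y in at_left x. h y \<le> h x"
  shows "mono_on {a<..<b} h"
proof (rule mono_onI)
  fix p q assume pq: "p \<in> {a<..<b}" "q \<in> {a<..<b}" "p \<le> q"
  show "h p \<le> h q"
  proof (rule real_interval_induct[where P="\<lambda>w. h p \<le> h w", OF pq(3)])
    fix s assume s: "p < s" "s \<le> q" and w: "\<And>w. p \<le> w \<Longrightarrow> w < s \<Longrightarrow> h p \<le> h w"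
    have "\<forall>\<^sub>F y in at_left s. h y \<le> h s" using pq s by (intro assms(2)) auto
    moreover have "\<forall>\<^sub>F y in at_left s. p < y \<and> y < s"
      unfolding eventually_at_left_field using s(1) by blast
    ultimately have "\<forall>\<^sub>F y in at_left s. h y \<le> h s \<and> p < y \<and> y < s"
      by (rule eventually_conj)
    then obtain y where "h y \<le> h s" "p < y" "y < s"
      using eventually_happens'[OF trivial_limit_at_left_real] by blast
    then show "h p \<le> h s" using w[of y] by linarith
  next
    fix s assume s: "p \<le> s" "s < q" and "h p \<le> h s"
    moreover have "\<forall>\<^sub>F y in at_right s. h s \<le> h y" using pq s by (intro assms(1)) auto
    ultimately show "\<forall>\<^sub>F y in at_right s. h p \<le> h y"
      by (auto elim!: eventually_mono)
  qed simp
qed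

text \<open>A mean value inequality for right difference quotients; continuity carries the estimate
  into each new endpoint. It is applied below with arbitrarily large c, and with c near a right
  derivative, to the function and to its negative.\<close>

lemma right_slope_ge_imp_ge:
  fixes g :: "real \<Rightarrow> real"
  assumes "a \<le> b" "continuous_on {a..b} g"
    and "\<And>x. a \<le> x \<Longrightarrow> x < b \<Longrightarrow> \<forall>\<^sub>F y in at_right x. c * (y - x) \<le> g y - g x"
  shows "c * (b - a) \<le> g b - g a"
proof (rule real_interval_induct[where P="\<lambda>w. c * (w - a) \<le> g w - g a", OF assms(1)])
  fix s assume s: "a < s" "s \<le> b" and w: "\<And>w. a \<le> w \<Longrightarrow> w < s \<Longrightarrow> c * (w - a) \<le> g w - g a"
  have "(g \<longlongrightarrow> g s) (at s within {a..s})"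
    using assms(2) s by (meson atLeastAtMost_iff continuous_on_def continuous_on_subset atLeastatMost_subset_iff less_imp_le order_refl)
  then have g: "(g \<longlongrightarrow> g s) (at_left s)"
    using s(1) by (simp add: at_within_Icc_at_left)
  show "c * (s - a) \<le> g s - g a"
  proof (rule tendsto_le[OF trivial_limit_at_left_real])
    show "((\<lambda>y. g y - g a) \<longlongrightarrow> g s - g a) (at_left s)" by (intro tendsto_intros g)
    show "((\<lambda>y. c * (y - a)) \<longlongrightarrow> c * (s - a)) (at_left s)" by (intro tendsto_intros)
    show "\<forall>\<^sub>F y in at_left s. c * (y - a) \<le> g y - g a"
      unfolding eventually_at_left_field using s(1) w by (meson less_imp_le)
  qed
next
  fix s assume s: "a \<le> s" "s < b" and *: "c * (s - a) \<le> g s - g a"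
  from assms(3)[OF s] show "\<forall>\<^sub>F y in at_right s. c * (y - a) \<le> g y - g a"
    by eventually_elim (use * in \<open>simp add: algebra_simps\<close>)
qed simp

text \<open>Each strict local minimum owns a rational interval on which its value is strictly
  smallest; two points sharing an interval would each have the smaller value.\<close>

lemma countable_strict_local_minima:
  fixes h :: "real \<Rightarrow> 'a :: linorder"
  shows "countable {x. \<forall>\<^sub>F y in at x. h x < h y}" (is "countable ?M")
proof -
  have "\<forall>x\<in>?M. \<exists>I. fst I \<in> \<rat> \<and> snd I \<in> \<rat> \<and> fst I < x \<and> x < snd I \<and>
      (\<forall>y. fst I < y \<longrightarrow> y < snd I \<longrightarrow> y \<noteq> x \<longrightarrow> h x < h y)"
  proof
    fix x assume "x \<in> ?M"
    then obtain d where d: "d > 0" "\<And>y. y \<noteq> x \<Longrightarrow> dist y x < d \<Longrightarrow> h x < h y"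
      by (auto simp: eventually_at)
    obtain p where "p \<in> \<rat>" "x - d < p" "p < x" using Rats_dense_in_real[of "x - d" x] d(1) by auto
    moreover obtain q where "q \<in> \<rat>" "x < q" "q < x + d" using Rats_dense_in_real[of x "x + d"] d(1) by auto
    ultimately show "\<exists>I. fst I \<in> \<rat> \<and> snd I \<in> \<rat> \<and> fst I < x \<and> x < snd I \<and>
      (\<forall>y. fst I < y \<longrightarrow> y < snd I \<longrightarrow> y \<noteq> x \<longrightarrow> h x < h y)"
      using d(2) by (intro exI[of _ "(p, q)"]) (auto simp: dist_real_def)
  qed
  from bchoice[OF this] obtain I where I: "\<And>x. x \<in> ?M \<Longrightarrow> fst (I x) \<in> \<rat> \<and> snd (I x) \<in> \<rat> \<and>
      fst (I x) < x \<and> x < snd (I x) \<and> (\<forall>y. fst (I x) < y \<longrightarrow> y < snd (I x) \<longrightarrow> y \<noteq> x \<longrightarrow> h x < h y)"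
    by blast
  have "inj_on I ?M"
  proof (rule inj_onI, rule ccontr)
    fix x y assume xy: "x \<in> ?M" "y \<in> ?M" "I x = I y" "x \<noteq> y"
    have "h x < h y" using I[OF xy(1)] I[OF xy(2)] xy(3,4) by metis
    moreover have "h y < h x" using I[OF xy(1)] I[OF xy(2)] xy(3,4) by metis
    ultimately show False by simp
  qed
  moreover have "countable (I ` ?M)"
  proof (rule countable_subset)
    show "I ` ?M \<subseteq> \<rat> \<times> \<rat>" unfolding image_subset_iff mem_Times_iff using I by blast
  qed (intro countable_SIGMA countable_rat)
  ultimately show ?thesis by (rule countable_image_inj_on[rotated])
qed

text \<open>If the interval meets every right neighbourhood of a, convexity fills the stretch
  between a and any of its points beyond a.\<close>

lemma eventually_at_right_interval:
  fixes I :: "real set"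
  assumes "is_interval I"
  shows "(\<forall>\<^sub>F y in at_right a. y \<in> I) \<or> (\<forall>\<^sub>F y in at_right a. y \<notin> I)"
proof (rule disjCI)
  assume "\<not> (\<forall>\<^sub>F y in at_right a. y \<notin> I)"
  then have *: "\<exists>y\<in>I. a < y \<and> y < b" if "b > a" for b
    using that unfolding eventually_at_right_field by blast
  then obtain c where c: "c \<in> I" "a < c" by (meson gt_ex)
  have "y \<in> I" if "a < y" "y < c" for y
    using *[OF that(1)] that c assms unfolding is_interval_1 by (meson less_imp_le)
  then show "\<forall>\<^sub>F y in at_right a. y \<in> I"
    unfolding eventually_at_right_field using c(2) by blast
qed

section \<open>The dichotomy for one-sided germs\<close>

context o_minimal_structure
begin

lemma definable_real_set:
  assumes "definable (\<lambda>e. P (e 0))"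
  shows "\<exists>F. finite F \<and> (\<forall>I\<in>F. is_interval (I :: real set)) \<and> {t. P t} = \<Union>F"
proof -
  obtain N A where A: "A \<in> S N" "\<And>e. P (e 0) \<longleftrightarrow> map e [0..<N] \<in> A"
    using assms unfolding definable_def by blast
  \<comment> \<open>P looks at variable 0 alone, so the environment may be constant; duplicating one
    coordinate N times pulls A back to the line.\<close>
  have P: "P t \<longleftrightarrow> replicate N t \<in> A" for t
    using A(2)[of "\<lambda>_. t"] by (simp add: map_replicate_const)
  have "{xs \<in> Rn 1. map ((!) xs) (replicate N 0) \<in> A} \<in> S 1"
    using A(1) by (intro reindex) auto
  also have "{xs \<in> Rn 1. map ((!) xs) (replicate N 0) \<in> A} = (\<lambda>t. [t]) ` {t. P t}"
    by (auto simp: Rn_def P length_Suc_conv)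
  finally obtain F where F: "finite F" "\<forall>I\<in>F. is_interval I" "(\<lambda>t. [t]) ` {t. P t} = (\<lambda>t::real. [t]) ` \<Union>F"
    unfolding o_minimal by blast
  have "inj (\<lambda>t::real. [t])" by (simp add: inj_def)
  then have "{t. P t} = \<Union>F" using F(3) by (simp only: inj_image_eq_iff)
  then show ?thesis using F by blast
qed

text \<open>A finite union of intervals either contains or misses a whole right neighbourhood of a.
  All later consequences of o-minimality are drawn from this dichotomy.\<close>

lemma germ_right_cases:
  assumes "definable (\<lambda>e. P (e 0))"
  obtains "\<forall>\<^sub>F y in at_right a. P y" | "\<forall>\<^sub>F y in at_right a. \<not> P y"
proof -
  obtain F where F: "finite F" "\<forall>I\<in>F. is_interval (I :: real set)" "{t. P t} = \<Union>F"
    using definable_real_set[OF assms] by blast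
  then have P: "P t \<longleftrightarrow> (\<exists>I\<in>F. t \<in> I)" for t by auto
  show ?thesis
  proof (cases "\<exists>I\<in>F. \<forall>\<^sub>F y in at_right a. y \<in> I")
    case True
    then obtain I where I: "I \<in> F" "\<forall>\<^sub>F y in at_right a. y \<in> I" by blast
    from I(2) have "\<forall>\<^sub>F y in at_right a. P y" by eventually_elim (use I(1) P in auto)
    then show ?thesis using that by blast
  next
    case False
    then have "\<forall>\<^sub>F y in at_right a. \<forall>I\<in>F. y \<notin> I"
      using F eventually_at_right_interval by (intro eventually_ball_finite) blast+
    then show ?thesis using that P by simp
  qed
qed

text \<open>A one-sided neighbourhood is a matter of two quantifiers, so the dichotomy can be
  applied again to statements that themselves speak of germs or limits.\<close>

lemma definable_eventually_at_right:
  assumes "definable (\<lambda>e. P (e 0) (\<lambda>i. e (Suc i)))" "definable_term a"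
  shows "definable (\<lambda>e. \<forall>\<^sub>F y in at_right (a e). P y e)"
proof -
  note a = definable_term_rename[OF assms(2), of Suc] definable_term_rename[OF assms(2), of "\<lambda>i. Suc (Suc i)"]
  \<comment> \<open>The renaming makes room for the endpoint of the neighbourhood, which is bound
    between y and the old variables.\<close>
  note P = definable_rename[OF assms(1), of "case_nat 0 (\<lambda>i. Suc (Suc i))", simplified]
  show ?thesis
    unfolding eventually_at_right_field
    by (intro definable_conj definable_imp definable_ex definable_all definable_less definable_term_var a P)
qed

lemma definable_eventually_at_left:
  assumes "definable (\<lambda>e. P (e 0) (\<lambda>i. e (Suc i)))" "definable_term a"
  shows "definable (\<lambda>e. \<forall>\<^sub>F y in at_left (a e). P y e)"
proof -
  note a = definable_term_rename[OF assms(2), of Suc] definable_term_rename[OF assms(2), of "\<lambda>i. Suc (Suc i)"]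
  note P = definable_rename[OF assms(1), of "case_nat 0 (\<lambda>i. Suc (Suc i))", simplified]
  show ?thesis
    unfolding eventually_at_left_field
    by (intro definable_conj definable_imp definable_ex definable_all definable_less definable_term_var a P)
qed

end

section \<open>Monotonicity, continuity and differentiability of germs\<close>

context o_minimal_real_field_expansion
begin

lemma germ_left_cases:
  assumes "definable (\<lambda>e. P (e 0))"
  obtains "\<forall>\<^sub>F y in at_left a. P y" | "\<forall>\<^sub>F y in at_left a. \<not> P y"
proof -
  have "definable (\<lambda>e. P (- e 0))"
    by (rule definable_comp1[OF assms]) (intro definable_intros)
  then show ?thesis
    by (rule germ_right_cases[of _ "- a"])
      (use that in \<open>auto simp: at_left_minus[of a] eventually_filtermap\<close>)
qed

text \<open>By the dichotomy, the values just right of x compare with \<open>h x\<close> in the same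
  way for all x near a, and likewise on the left. Strict local extrema at all these x would be
  uncountably many; the remaining combinations are locally monotone.\<close>

lemma germ_monotone:
  assumes h: "definable_term (\<lambda>e. h (e 0))"
  obtains b where "b > a" "mono_on {a<..<b} h \<or> antimono_on {a<..<b} h"
proof -
  note h' = h[THEN definable_term_comp1]
  note di = definable_eventually_at_right definable_eventually_at_left definable_intros h'
  have no_min: False if k: "\<forall>\<^sub>F x in at_right a. \<forall>\<^sub>F y in at_right x. k x < k y"
    "\<forall>\<^sub>F x in at_right a. \<forall>\<^sub>F y in at_left x. k x < k y" for k :: "real \<Rightarrow> real"
  proof -
    from k have "\<forall>\<^sub>F x in at_right a. \<forall>\<^sub>F y in at x. k x < k y"
      by eventually_elim (simp add: eventually_at_split)
    then obtain b where "b > a" "\<And>x. a < x \<Longrightarrow> x < b \<Longrightarrow> \<forall>\<^sub>F y in at x. k x < k y"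
      unfolding eventually_at_right_field by blast
    then have b: "b > a" "{a<..<b} \<subseteq> {x. \<forall>\<^sub>F y in at x. k x < k y}" by auto
    from countable_subset[OF b(2) countable_strict_local_minima] show False
      using uncountable_open_interval[of a b] b(1) by simp
  qed
  have mono: "\<exists>b>a. mono_on {a<..<b} k" if k: "\<forall>\<^sub>F x in at_right a. \<forall>\<^sub>F y in at_right x. k x \<le> k y"
    "\<forall>\<^sub>F x in at_right a. \<forall>\<^sub>F y in at_left x. k y \<le> k x" for k :: "real \<Rightarrow> real"
  proof -
    from eventually_conj[OF k] obtain b where "b > a" "\<And>x. a < x \<Longrightarrow> x < b \<Longrightarrow>
       (\<forall>\<^sub>F y in at_right x. k x \<le> k y) \<and> (\<forall>\<^sub>F y in at_left x. k y \<le> k x)"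
      unfolding eventually_at_right_field[of _ a] by blast
    then show ?thesis by (intro exI[of _ b] conjI locally_mono_imp_mono_on) auto
  qed
  have anti: "\<exists>b>a. antimono_on {a<..<b} h" if "\<forall>\<^sub>F x in at_right a. \<forall>\<^sub>F y in at_right x. h y \<le> h x"
    "\<forall>\<^sub>F x in at_right a. \<forall>\<^sub>F y in at_left x. h x \<le> h y"
    using mono[of "\<lambda>x. - h x"] that by (auto simp: monotone_on_def)
  \<comment> \<open>The dichotomy is used twice: for y near a fixed x, and then, as the resulting
    germ statement is definable in x, for x near a.\<close>
  have split: "(\<forall>\<^sub>F x in at_right a. \<forall>\<^sub>F y in at_right x. R x y) \<or> (\<forall>\<^sub>F x in at_right a. \<forall>\<^sub>F y in at_right x. \<not> R x y)"
    "(\<forall>\<^sub>F x in at_right a. \<forall>\<^sub>F y in at_left x. R x y) \<or> (\<forall>\<^sub>F x in at_right a. \<forall>\<^sub>F y in at_left x. \<not> R x y)"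
    if R: "definable (\<lambda>e. R (e (Suc 0)) (e 0))" for R
  proof -
    have R1: "definable (\<lambda>e. R x (e 0))" for x
      using definable_comp2[where P="\<lambda>y x. R x y" and v="\<lambda>e. x", OF R definable_term_var definable_term_const] .
    have neg_right: "\<forall>\<^sub>F y in at_right x. \<not> R x y" if "\<not> (\<forall>\<^sub>F y in at_right x. R x y)" for x
      using that germ_right_cases[OF R1[of x], of x] by blast
    have neg_left: "\<forall>\<^sub>F y in at_left x. \<not> R x y" if "\<not> (\<forall>\<^sub>F y in at_left x. R x y)" for x
      using that germ_left_cases[OF R1[of x], of x] by blast
    have "definable (\<lambda>e. \<forall>\<^sub>F y in at_right (e 0). R (e 0) y)"
      by (intro di R)
    then show "(\<forall>\<^sub>F x in at_right a. \<forall>\<^sub>F y in at_right x. R x y) \<or> (\<forall>\<^sub>F x in at_right a. \<forall>\<^sub>F y in at_right x. \<not> R x y)"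
      by (rule germ_right_cases[of _ a]) (use neg_right in \<open>blast intro: eventually_mono\<close>)+
    have "definable (\<lambda>e. \<forall>\<^sub>F y in at_left (e 0). R (e 0) y)"
      by (intro di R)
    then show "(\<forall>\<^sub>F x in at_right a. \<forall>\<^sub>F y in at_left x. R x y) \<or> (\<forall>\<^sub>F x in at_right a. \<forall>\<^sub>F y in at_left x. \<not> R x y)"
      by (rule germ_right_cases[of _ a]) (use neg_left in \<open>blast intro: eventually_mono\<close>)+
  qed
  have gt: "definable (\<lambda>e. h (e (Suc 0)) < h (e 0))" and lt: "definable (\<lambda>e. h (e 0) < h (e (Suc 0)))"
    by (intro di)+
  define E where "E A R \<longleftrightarrow> (\<forall>\<^sub>F x in at_right a. \<forall>\<^sub>F y in A x. R (h x) (h y))"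
    for A :: "real \<Rightarrow> real filter" and R :: "real \<Rightarrow> real \<Rightarrow> bool"
  have weak: "E A (\<le>)" if "E A (<)" for A
    using that unfolding E_def by (auto elim!: eventually_mono)
  have weak': "E A (\<ge>)" if "E A (>)" for A
    using that unfolding E_def by (auto elim!: eventually_mono)
  have "E at_right (<) \<or> E at_right (\<ge>)" "E at_left (<) \<or> E at_left (\<ge>)"
    "E at_right (>) \<or> E at_right (\<le>)" "E at_left (>) \<or> E at_left (\<le>)"
    using split[where R="\<lambda>x y. h x < h y", OF gt] split[where R="\<lambda>x y. h y < h x", OF lt]
    unfolding not_less E_def by blast+
  moreover have "\<not> (E at_right (<) \<and> E at_left (<))"
    using no_min[of h] unfolding E_def by blast
  moreover have "\<not> (E at_right (>) \<and> E at_left (>))"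
    using no_min[of "\<lambda>x. - h x"] unfolding E_def by auto
  moreover have "\<exists>b>a. mono_on {a<..<b} h" if "E at_right (\<le>)" "E at_left (\<ge>)"
    using mono[of h] that unfolding E_def by simp
  moreover have "\<exists>b>a. antimono_on {a<..<b} h" if "E at_right (\<ge>)" "E at_left (\<le>)"
    using anti that unfolding E_def by simp
  \<comment> \<open>If the comparison on the right is strict, excluding extrema forces the matching
    one on the left. If it is weak both ways, either outcome on the left fits one of the two
    conclusions.\<close>
  ultimately have "(\<exists>b>a. mono_on {a<..<b} h) \<or> (\<exists>b>a. antimono_on {a<..<b} h)"
    using weak weak' by blast
  then show ?thesis using that by blast
qed

text \<open>A monotone function has only countably many discontinuities, so it cannot be
  discontinuous throughout an interval, and the dichotomy leaves continuity.\<close>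

lemma germ_continuous:
  assumes h: "definable_term (\<lambda>e. h (e 0))"
  shows "\<forall>\<^sub>F x in at_right a. isCont h x"
proof -
  have "definable (\<lambda>e. isCont h (e 0))"
    unfolding continuous_at_real_range real_norm_def
    by (intro definable_intros definable_term_abs h[THEN definable_term_comp1])
  then show ?thesis
  proof (rule germ_right_cases[of _ a])
    assume "\<forall>\<^sub>F x in at_right a. \<not> isCont h x"
    then obtain c where c: "c > a" "\<And>x. a < x \<Longrightarrow> x < c \<Longrightarrow> \<not> isCont h x"
      unfolding eventually_at_right_field by auto
    obtain b where b: "b > a" "mono_on {a<..<b} h \<or> antimono_on {a<..<b} h"
      using germ_monotone[OF h] by blast
    have "countable {x \<in> {a<..<b}. \<not> continuous (at x within {a<..<b}) h}"
      using b(2)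
    proof
      assume "antimono_on {a<..<b} h"
      then have "mono_on {a<..<b} (\<lambda>x. - h x)" by (simp add: monotone_on_def)
      then have *: "countable {x \<in> {a<..<b}. \<not> continuous (at x within {a<..<b}) (\<lambda>x. - h x)}"
        by (rule mono_on_ctble_discont)
      show ?thesis
        by (rule countable_subset[OF _ *]) (use continuous_minus in force)
    qed (rule mono_on_ctble_discont)
    moreover have "{a<..<min b c} \<subseteq> {x \<in> {a<..<b}. \<not> continuous (at x within {a<..<b}) h}"
    proof (rule subsetI)
      fix x assume "x \<in> {a<..<min b c}"
      then have x: "x \<in> {a<..<b}" "\<not> isCont h x" using c(2)[of x] by auto
      then show "x \<in> {x \<in> {a<..<b}. \<not> continuous (at x within {a<..<b}) h}"
        using at_within_open[OF x(1) open_greaterThanLessThan] by simp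
    qed
    ultimately have "countable {a<..<min b c}" by (rule countable_subset[rotated])
    then show ?thesis using b(1) c(1) uncountable_open_interval[of a "min b c"] by simp
  qed
qed

text \<open>The dichotomy compares q with every constant and so defines a Dedekind cut, nonempty
  thanks to m. Its supremum is the limit; an unbounded cut means divergence to infinity.\<close>

lemma germ_limit:
  assumes q: "definable_term (\<lambda>e. q (e 0))" and lower: "\<forall>\<^sub>F y in at_right a. m \<le> q y"
  shows "(\<exists>l. (q \<longlongrightarrow> l) (at_right a)) \<or> filterlim q at_top (at_right a)"
proof -
  let ?L = "{c. \<forall>\<^sub>F y in at_right a. c < q y}"
  have compl: "\<forall>\<^sub>F y in at_right a. q y \<le> c" if "c \<notin> ?L" for c
  proof -
    have "definable (\<lambda>e. c < q (e 0))" by (intro definable_intros q)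
    then show ?thesis
      by (rule germ_right_cases[of _ a]) (use that in \<open>auto simp: not_less\<close>)
  qed
  have down: "c \<in> ?L" if "d \<in> ?L" "c \<le> d" for c d
    using that by (auto elim!: eventually_mono)
  have ne: "m - 1 \<in> ?L" using lower by (auto elim!: eventually_mono)
  show ?thesis
  proof (cases "bdd_above ?L")
    case True
    have "(q \<longlongrightarrow> Sup ?L) (at_right a)"
    proof (rule order_tendstoI)
      fix c assume "c < Sup ?L"
      then have "\<exists>d\<in>?L. c < d" using True ne by (subst (asm) less_cSup_iff) blast+
      then have "c \<in> ?L" using down by (meson less_imp_le)
      then show "\<forall>\<^sub>F y in at_right a. c < q y" by simp
    next
      fix c assume c: "Sup ?L < c"
      then obtain d where d: "Sup ?L < d" "d < c" using dense by blast
      then have "d \<notin> ?L" using cSup_upper[OF _ True, of d] by (metis not_le)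
      from compl[OF this] show "\<forall>\<^sub>F y in at_right a. q y < c"
        by eventually_elim (use d(2) in simp)
    qed
    then show ?thesis by blast
  next
    case False
    have "\<forall>\<^sub>F y in at_right a. Z \<le> q y" for Z
    proof -
      have "\<exists>d\<in>?L. Z < d" using False unfolding bdd_above_def by (meson not_le)
      then have "Z \<in> ?L" using down by (meson less_imp_le)
      then show ?thesis by (auto elim!: eventually_mono)
    qed
    then show ?thesis by (simp add: filterlim_at_top)
  qed
qed

text \<open>An infinite right derivative on a whole interval would make the increment of \<open>g\<close> over it
  exceed every bound; hence the right derivative is finite near \<open>a\<close>, and where it is continuous
  it is the derivative.\<close>

lemma germ_C1:
  assumes g: "definable_term (\<lambda>e. g (e 0))" and "a < b" and mono: "mono_on {a<..<b} g"
  obtains c D where "a < c" "c \<le> b"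
    "\<And>x. x \<in> {a<..<c} \<Longrightarrow> (g has_real_derivative D x) (at x)"
    "definable_term (\<lambda>e. D (e 0))" "continuous_on {a<..<c} D"
    "mono_on {a<..<c} D \<or> antimono_on {a<..<c} D"
proof -
  define q where "q x y = (g y - g x) / (y - x)" for x y
  have q: "definable_term (\<lambda>e. q (u e) (v e))" if "definable_term u" "definable_term v" for u v
    unfolding q_def by (intro definable_term_divide definable_intros g[THEN definable_term_comp1] that)
  define fin where "fin x l \<longleftrightarrow> (q x \<longlongrightarrow> l) (at_right x)" for x l
  have fin: "definable (\<lambda>e. fin (u e) (v e))" if "definable_term u" "definable_term v" for u v
  proof (rule definable_comp2[where P=fin, OF _ that])
    show "definable (\<lambda>e. fin (e 0) (e (Suc 0)))"
      unfolding fin_def tendsto_iff dist_real_def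
      by (intro definable_eventually_at_right definable_term_abs definable_intros q)
  qed
  obtain b1 where b1: "a < b1" "\<And>x. a < x \<Longrightarrow> x < b1 \<Longrightarrow> isCont g x"
    using germ_continuous[OF g, of a] unfolding eventually_at_right_field by blast
  have "\<forall>\<^sub>F x in at_right a. \<exists>l. fin x l"
  proof -
    have "definable (\<lambda>e. \<exists>l. fin (e 0) l)" by (intro definable_intros fin)
    then show ?thesis
    proof (rule germ_right_cases[of _ a])
      assume "\<forall>\<^sub>F x in at_right a. \<not> (\<exists>l. fin x l)"
      then obtain b2 where b2: "a < b2" "\<And>x l. a < x \<Longrightarrow> x < b2 \<Longrightarrow> \<not> fin x l"
        unfolding eventually_at_right_field by blast
      define c where "c = min b (min b1 b2)"
      have c: "a < c" "c \<le> b" "c \<le> b1" "c \<le> b2" using assms(2) b1(1) b2(1) by (auto simp: c_def)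
      \<comment> \<open>Monotonicity makes the quotients nonnegative, so the absence of a finite
        limit can only mean divergence to +infinity.\<close>
      have top: "filterlim (q x) at_top (at_right x)" if x: "a < x" "x < c" for x
      proof -
        have "\<forall>\<^sub>F y in at_right x. 0 \<le> q x y"
          unfolding eventually_at_right_field
        proof (intro exI[of _ c] conjI allI impI)
          fix y assume "x < y" "y < c"
          then show "0 \<le> q x y" unfolding q_def using mono_onD[OF mono, of x y] x c by simp
        qed (use x in simp)
        moreover have "definable_term (\<lambda>e. q x (e 0))" by (intro q definable_intros)
        ultimately have "(\<exists>l. (q x \<longlongrightarrow> l) (at_right x)) \<or> filterlim (q x) at_top (at_right x)"
          by (intro germ_limit)
        then show ?thesis using b2(2)[of x] x c unfolding fin_def by auto
      qed
      obtain p where p: "a < p" "p < c" using dense c(1) by blast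
      obtain r where r: "p < r" "r < c" using dense p(2) by blast
      have ge: "K * (r - p) \<le> g r - g p" for K
      proof (rule right_slope_ge_imp_ge)
        show "continuous_on {p..r} g"
          using b1(2) p r c by (intro continuous_at_imp_continuous_on) auto
        fix x assume x: "p \<le> x" "x < r"
        have "\<forall>\<^sub>F y in at_right x. K \<le> q x y"
          using top[of x] x p r by (simp add: filterlim_at_top)
        moreover have "\<forall>\<^sub>F y in at_right x. x < y" by (rule eventually_at_right_less)
        ultimately show "\<forall>\<^sub>F y in at_right x. K * (y - x) \<le> g y - g x"
          by eventually_elim (simp add: q_def pos_le_divide_eq)
      qed (use r in simp)
      \<comment> \<open>With this K, the lower bound \<open>K * (r - p)\<close> exceeds the actual
        increment by 1.\<close>
      have "(g r - g p + 1) / (r - p) * (r - p) = g r - g p + 1" using r by simp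
      then show ?thesis using ge[of "(g r - g p + 1) / (r - p)"] by simp
    qed
  qed
  then obtain b2 where b2: "a < b2" "\<And>x. a < x \<Longrightarrow> x < b2 \<Longrightarrow> \<exists>l. fin x l"
    unfolding eventually_at_right_field by blast
  \<comment> \<open>The default 0 makes D a total definable function, to which the germ lemmas
    apply; near a it is never taken.\<close>
  define D where "D x = (if \<exists>l. fin x l then THE l. fin x l else 0)" for x
  have fin_unique: "fin x l \<Longrightarrow> fin x l' \<Longrightarrow> l = l'" for x l l'
    unfolding fin_def by (rule tendsto_unique[OF trivial_limit_at_right_real])
  have D_eq: "D x = l" if "fin x l" for x l
    unfolding D_def using that fin_unique by auto
  have D: "definable_term (\<lambda>e. D (e 0))"
  proof (rule definable_termI)
    fix t :: real and e :: "nat \<Rightarrow> real"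
    show "t = D (e 0) \<longleftrightarrow> fin (e 0) t \<or> (\<not> (\<exists>l. fin (e 0) l) \<and> t = 0)"
    proof (cases "\<exists>l. fin (e 0) l")
      case True
      then show ?thesis using D_eq by blast
    qed (simp add: D_def)
  qed (intro definable_intros fin)
  obtain b3 where b3: "a < b3" "\<And>x. a < x \<Longrightarrow> x < b3 \<Longrightarrow> isCont D x"
    using germ_continuous[OF D, of a] unfolding eventually_at_right_field by blast
  obtain b4 where b4: "a < b4" "mono_on {a<..<b4} D \<or> antimono_on {a<..<b4} D"
    using germ_monotone[OF D] by blast
  define c where "c = min (min b b1) (min b2 (min b3 b4))"
  have c: "a < c" "c \<le> b" "c \<le> b1" "c \<le> b2" "c \<le> b3" "c \<le> b4"
    using assms(2) b1(1) b2(1) b3(1) b4(1) by (auto simp: c_def)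
  \<comment> \<open>If the right derivative stays within \<epsilon> of \<open>D x\<close> on a
    segment, so does the mean slope, whichever side of x the segment lies on. This turns the right
    derivative into a two-sided one.\<close>
  have bounds: "(D x - \<epsilon>) * (r - p) \<le> g r - g p \<and> g r - g p \<le> (D x + \<epsilon>) * (r - p)"
    if pr: "a < p" "p \<le> r" "r < c" and near: "\<And>y. p \<le> y \<Longrightarrow> y \<le> r \<Longrightarrow> \<bar>D y - D x\<bar> < \<epsilon>" for x p r \<epsilon>
  proof -
    have cont: "continuous_on {p..r} g"
      using b1(2) pr c by (intro continuous_at_imp_continuous_on) auto
    have ev: "\<forall>\<^sub>F z in at_right y. (D x - \<epsilon>) * (z - y) \<le> g z - g y \<and> g z - g y \<le> (D x + \<epsilon>) * (z - y)"
      if y: "p \<le> y" "y < r" for y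
    proof -
      obtain l where l: "fin y l" using b2(2)[of y] y pr c by auto
      then have lim: "(q y \<longlongrightarrow> D y) (at_right y)" using D_eq unfolding fin_def by simp
      have "D x - \<epsilon> < D y" "D y < D x + \<epsilon>" using near[of y] y by auto
      from order_tendstoD(1)[OF lim this(1)] order_tendstoD(2)[OF lim this(2)]
        eventually_at_right_less[of y]
      show ?thesis
        by eventually_elim (simp add: q_def pos_less_divide_eq pos_divide_less_eq)
    qed
    have "(D x - \<epsilon>) * (r - p) \<le> g r - g p"
      by (rule right_slope_ge_imp_ge[OF pr(2) cont]) (rule eventually_mono[OF ev], auto)
    moreover have "- (D x + \<epsilon>) * (r - p) \<le> (- g r) - (- g p)"
    proof (rule right_slope_ge_imp_ge[OF pr(2) continuous_on_minus[OF cont]])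
      fix y assume "p \<le> y" "y < r"
      from ev[OF this] show "\<forall>\<^sub>F z in at_right y. - (D x + \<epsilon>) * (z - y) \<le> - g z - - g y"
        by (rule eventually_mono) (simp add: algebra_simps)
    qed
    ultimately show ?thesis by (simp add: algebra_simps)
  qed
  have deriv: "(g has_real_derivative D x) (at x)" if x: "x \<in> {a<..<c}" for x
    unfolding has_field_derivative_iff
  proof (rule tendstoI)
    fix e :: real assume "e > 0"
    have "isCont D x" using b3(2) x c by auto
    \<comment> \<open>Half of e, because \<open>bounds\<close> yields weak inequalities and the
      limit asks for a strict one.\<close>
    then obtain d where d: "d > 0" "\<And>y. \<bar>y - x\<bar> < d \<Longrightarrow> \<bar>D y - D x\<bar> < e / 2"
      unfolding continuous_at_real_range real_norm_def using \<open>e > 0\<close> by (meson half_gt_zero)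
    define d' where "d' = min d (min (x - a) (c - x))"
    have d': "d' > 0" "d' \<le> d" "d' \<le> x - a" "d' \<le> c - x" using d(1) x by (auto simp: d'_def)
    show "\<forall>\<^sub>F y in at x. dist ((g y - g x) / (y - x)) (D x) < e"
      unfolding eventually_at
    proof (intro exI[of _ d'] conjI ballI impI d'(1))
      fix y assume y: "y \<noteq> x \<and> dist y x < d'"
      then have y': "\<bar>y - x\<bar> < d'" by (simp add: dist_real_def)
      have *: "\<bar>(g y - g x) / (y - x) - D x\<bar> \<le> e / 2"
      proof (cases "x < y")
        case True
        then have "(D x - e / 2) * (y - x) \<le> g y - g x \<and> g y - g x \<le> (D x + e / 2) * (y - x)"
          using y' d' x d(2) by (intro bounds) auto
        then have "D x - e / 2 \<le> (g y - g x) / (y - x)" "(g y - g x) / (y - x) \<le> D x + e / 2"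
          using True by (simp_all add: pos_le_divide_eq pos_divide_le_eq)
        then show ?thesis by (intro abs_leI) linarith+
      next
        case False
        then have yx: "y < x" using y by simp
        then have "(D x - e / 2) * (x - y) \<le> g x - g y \<and> g x - g y \<le> (D x + e / 2) * (x - y)"
          using y' d' x d(2) by (intro bounds) auto
        then have "D x - e / 2 \<le> (g x - g y) / (x - y)" "(g x - g y) / (x - y) \<le> D x + e / 2"
          using yx by (simp_all add: pos_le_divide_eq pos_divide_le_eq)
        moreover have "(g x - g y) / (x - y) = (g y - g x) / (y - x)"
          using minus_divide_divide[of "g x - g y" "x - y"] by simp
        ultimately have "D x - e / 2 \<le> (g y - g x) / (y - x)" "(g y - g x) / (y - x) \<le> D x + e / 2"
          by simp_all
        then show ?thesis by (intro abs_leI) linarith+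
      qed
      show "dist ((g y - g x) / (y - x)) (D x) < e"
        unfolding dist_real_def using * \<open>e > 0\<close> by simp
    qed
  qed
  show ?thesis
  proof (rule that[OF c(1,2) deriv D])
    show "continuous_on {a<..<c} D"
      using b3(2) c by (intro continuous_at_imp_continuous_on) auto
    show "mono_on {a<..<c} D \<or> antimono_on {a<..<c} D"
    proof -
      have "{a<..<c} \<subseteq> {a<..<b4}" using c(6) by auto
      then show ?thesis using b4(2) monotone_on_subset by blast
    qed
  qed
qed

end

section \<open>Definable choice\<close>

context o_minimal_real_field_expansion
begin

text \<open>Being a greatest lower bound is first-order. The value 0 for sets that are empty or
  unbounded below keeps the infimum total, so that it can be substituted as a term.\<close>

lemma definable_Inf:
  assumes R: "\<And>u v. definable_term u \<Longrightarrow> definable_term v \<Longrightarrow> definable (\<lambda>e. R (u e) (v e))"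
    and I: "\<And>t. I t = (if (\<exists>s. R t s) \<and> bdd_below {s. R t s} then Inf {s. R t s} else 0)"
    and u: "definable_term u"
  shows "definable_term (\<lambda>e. I (u e))"
proof (rule definable_term_comp1[OF _ u], rule definable_termI)
  fix s :: real and e :: "nat \<Rightarrow> real"
  let ?X = "{s. R (e 0) s}"
  show "s = I (e 0) \<longleftrightarrow>
      ((\<exists>s. R (e 0) s) \<and> (\<forall>z. R (e 0) z \<longrightarrow> s \<le> z) \<and> (\<forall>i. (\<forall>z. R (e 0) z \<longrightarrow> i \<le> z) \<longrightarrow> i \<le> s)) \<or>
      (\<not> ((\<exists>s. R (e 0) s) \<and> (\<exists>i. \<forall>z. R (e 0) z \<longrightarrow> i \<le> z)) \<and> s = 0)" (is "_ \<longleftrightarrow> ?A \<or> ?B")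
  proof (cases "?X \<noteq> {} \<and> bdd_below ?X")
    case True
    have 1: "?A" if "s = Inf ?X"
      using True cInf_lower[of _ ?X] cInf_greatest[of ?X] unfolding that by auto
    have 2: "s = Inf ?X" if "?A"
      unfolding eq_commute[of s]
      using that by (intro cInf_eq_non_empty) auto
    have 3: "\<not> ?B" using True by (auto simp: bdd_below_def)
    have 4: "I (e 0) = Inf ?X" using True I[of "e 0"] by auto
    show ?thesis unfolding 4 using 1 2 3 by (intro iffI disjI1) (assumption | erule disjE notE)+
  next
    case False
    then have *: "\<not> ((\<exists>s. R (e 0) s) \<and> (\<exists>i. \<forall>z. R (e 0) z \<longrightarrow> i \<le> z))"
      by (auto simp: bdd_below_def)
    moreover have "I (e 0) = 0" using False I[of "e 0"] by auto
    ultimately show ?thesis by auto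
  qed
next
  show "definable (\<lambda>e.
      ((\<exists>s. R (e (Suc 0)) s) \<and> (\<forall>z. R (e (Suc 0)) z \<longrightarrow> e 0 \<le> z) \<and> (\<forall>i. (\<forall>z. R (e (Suc 0)) z \<longrightarrow> i \<le> z) \<longrightarrow> i \<le> e 0)) \<or>
      (\<not> ((\<exists>s. R (e (Suc 0)) s) \<and> (\<exists>i. \<forall>z. R (e (Suc 0)) z \<longrightarrow> i \<le> z)) \<and> e 0 = 0))"
    by (intro definable_intros R)
qed

text \<open>An attained infimum is a canonical choice. By the germ dichotomy, an infimum that is not
  attained is the left end of an interval of solutions; the midpoint of the longest such interval of
  length at most 1 is chosen.\<close>

lemma definable_choice_real:
  assumes R: "definable (\<lambda>e. R (e 0) (e (Suc 0)))" and lower: "\<And>t s. R t s \<Longrightarrow> m \<le> s"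
  shows "\<exists>h. definable_term (\<lambda>e. h (e 0)) \<and> (\<forall>t s. R t s \<longrightarrow> R t (h t))"
proof -
  note R' = definable_comp2[where P=R, OF R]
  define I where "I t = (if (\<exists>s. R t s) \<and> bdd_below {s. R t s} then Inf {s. R t s} else 0)" for t
  note I = definable_Inf[OF R', OF _ _ I_def]
  \<comment> \<open>The right end of the interval is a supremum; passing to -c makes it an infimum,
    so that \<open>definable_Inf\<close> serves again. The cap \<open>I t + 1\<close> keeps it
    finite.\<close>
  define Q where "Q t c \<longleftrightarrow> I t < - c \<and> - c \<le> I t + 1 \<and> (\<forall>z. I t < z \<longrightarrow> z < - c \<longrightarrow> R t z)" for t c
  have Q: "definable (\<lambda>e. Q (u e) (v e))" if "definable_term u" "definable_term v" for u v
  proof (rule definable_comp2[where P=Q, OF _ that])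
    show "definable (\<lambda>e. Q (e 0) (e (Suc 0)))"
      unfolding Q_def by (intro definable_intros R' I)
  qed
  define J where "J t = (if (\<exists>s. Q t s) \<and> bdd_below {s. Q t s} then Inf {s. Q t s} else 0)" for t
  note J = definable_Inf[OF Q, OF _ _ J_def]
  \<comment> \<open>The right end is \<open>- J t\<close>, so \<open>(I t - J t) / 2\<close> is the
    midpoint.\<close>
  define h where "h t = (if R t (I t) then I t else (I t - J t) / 2)" for t
  have "R t (h t)" if "R t s" for t s
  proof (cases "R t (I t)")
    case False
    let ?X = "{s. R t s}"
    have bdd: "bdd_below ?X" using lower by (intro bdd_belowI[of _ m]) auto
    have It: "I t = Inf ?X" using that bdd unfolding I_def by auto
    have lt: "I t < z" if "R t z" for z
    proof -
      have "I t \<le> z" unfolding It using that bdd by (intro cInf_lower) auto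
      moreover have "I t \<noteq> z" using False that by auto
      ultimately show ?thesis by simp
    qed
    have "definable (\<lambda>e. R t (e 0))" by (intro R' definable_intros)
    then have "\<forall>\<^sub>F y in at_right (I t). R t y"
    proof (rule germ_right_cases[of _ "I t"])
      assume "\<forall>\<^sub>F y in at_right (I t). \<not> R t y"
      then obtain b where b: "b > I t" "\<And>y. I t < y \<Longrightarrow> y < b \<Longrightarrow> \<not> R t y"
        unfolding eventually_at_right_field by blast
      have "b \<le> Inf ?X" using that b(2) lt by (intro cInf_greatest) (auto, meson not_le)
      then show ?thesis using b(1) It by simp
    qed
    then obtain b where b: "b > I t" "\<And>y. I t < y \<Longrightarrow> y < b \<Longrightarrow> R t y"
      unfolding eventually_at_right_field by blast
    define c where "c = min b (I t + 1)"
    have c: "c > I t" "Q t (- c)" using b unfolding Q_def c_def by auto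
    have bddQ: "bdd_below {s. Q t s}" by (intro bdd_belowI[of _ "- (I t + 1)"]) (auto simp: Q_def)
    have Jt: "J t = Inf {s. Q t s}" using c(2) bddQ unfolding J_def by auto
    have "J t \<le> - c" unfolding Jt using c(2) bddQ by (intro cInf_lower) auto
    then have J_less: "I t < - J t" using c(1) by simp
    define w where "w = (I t - J t) / 2"
    have w: "I t < w" using J_less by (simp add: w_def)
    have w': "J t < - w" using J_less by (simp add: w_def field_simps)
    have "\<exists>c\<in>{s. Q t s}. c < - w" using w' c(2) bddQ unfolding Jt by (subst (asm) cInf_less_iff) auto
    then obtain c' where "Q t c'" "w < - c'" by auto
    then have "R t w" using w unfolding Q_def by blast
    then show ?thesis using False by (simp add: h_def w_def)
  qed (simp add: h_def)
  moreover have "definable_term (\<lambda>e. h (e 0))"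
    unfolding h_def by (intro definable_term_if definable_term_divide definable_intros R' I J)
  ultimately show ?thesis by blast
qed

text \<open>The induction chooses the first n coordinates for the projected relation, then the last
  one by \<open>definable_choice_real\<close>; the common lower bound m provides the infima.\<close>

lemma definable_choice:
  assumes "definable (\<lambda>e. P (e 0) (map (\<lambda>i. e (Suc i)) [0..<n]))"
    and "\<And>t y i. P t y \<Longrightarrow> y \<in> Rn n \<Longrightarrow> i < n \<Longrightarrow> m \<le> y ! i"
  shows "\<exists>X. (\<forall>i. definable_term (\<lambda>e. X i (e 0))) \<and>
    (\<forall>t. (\<exists>y\<in>Rn n. P t y) \<longrightarrow> P t (map (\<lambda>i. X i t) [0..<n]))"
  using assms
proof (induction n arbitrary: P)
  case 0
  then show ?case by (intro exI[of _ "\<lambda>i t. 0"]) (auto simp: Rn_def intro: definable_term_const)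
next
  case (Suc n)
  let ?Q = "\<lambda>t y. \<exists>s. P t (y @ [s])"
  have *: "map (\<lambda>i. e (if i < n then Suc (Suc i) else 0)) [0..<n] = map (\<lambda>i. e (Suc (Suc i))) [0..<n]"
    for e :: "nat \<Rightarrow> real" by (intro map_cong) auto
  have "definable (\<lambda>e. P (e (Suc 0)) (map (\<lambda>i. e (Suc (Suc i))) [0..<n] @ [e 0]))"
    using definable_rename[OF Suc.prems(1), of "\<lambda>i. case i of 0 \<Rightarrow> Suc 0 | Suc i \<Rightarrow> if i < n then Suc (Suc i) else 0"]
    by (simp add: *)
  then have "definable (\<lambda>e. ?Q (e 0) (map (\<lambda>i. e (Suc i)) [0..<n]))"
    by (rule definable_ex)
  moreover have "m \<le> y ! i" if "?Q t y" "y \<in> Rn n" "i < n" for t y i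
  proof -
    from that(1) obtain s where "P t (y @ [s])" by blast
    from Suc.prems(2)[OF this, of i] that show ?thesis by (simp add: Rn_def nth_append)
  qed
  ultimately obtain X where X: "\<And>i. definable_term (\<lambda>e. X i (e 0))"
    "\<And>t y. y \<in> Rn n \<Longrightarrow> ?Q t y \<Longrightarrow> ?Q t (map (\<lambda>i. X i t) [0..<n])"
    using Suc.IH[of ?Q] by blast
  let ?R = "\<lambda>t s. P t (map (\<lambda>i. X i t) [0..<n] @ [s])"
  \<comment> \<open>The chosen coordinates are substituted as functions of t, which leaves t and the
    last coordinate s as variables 0 and 1.\<close>
  let ?u = "\<lambda>i e. case i of 0 \<Rightarrow> e 0 | Suc i \<Rightarrow> if i < n then X i (e 0) else e (Suc 0)"
  have u: "definable_term (?u i)" for i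
    by (cases i) (use X(1) in \<open>auto intro: definable_term_if definable_const definable_term_var\<close>)
  have *: "map (\<lambda>i. if i < n then X i t else s) [0..<n] = map (\<lambda>i. X i t) [0..<n]" for t s
    by (intro map_cong) auto
  have "definable (\<lambda>e. ?R (e 0) (e (Suc 0)))"
    using definable_comp[where u="?u", OF Suc.prems(1) u] by (simp add: *)
  moreover have "m \<le> s" if "?R t s" for t s
    using Suc.prems(2)[OF that, of n] by (simp add: Rn_def nth_append)
  ultimately obtain h where h: "definable_term (\<lambda>e. h (e 0))" "\<And>t s. ?R t s \<Longrightarrow> ?R t (h t)"
    using definable_choice_real[of ?R m] by blast
  show ?case
  proof (intro exI[of _ "X(n := h)"] conjI allI impI)
    fix t assume "\<exists>y\<in>Rn (Suc n). P t y"
    then obtain y s where "y \<in> Rn n" "P t (y @ [s])" by (auto simp: Rn_def length_Suc_conv_rev)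
    then have "?R t (h t)" using X(2)[of y t] h(2) by blast
    moreover have *: "map (\<lambda>i. (X(n := h)) i t) [0..<n] = map (\<lambda>i. X i t) [0..<n]"
      by (intro map_cong) auto
    ultimately show "P t (map (\<lambda>i. (X(n := h)) i t) [0..<Suc n])"
      unfolding upt_Suc_append[OF le0] map_append * by simp
  qed (use X(1) h(1) in auto)
qed

end

section \<open>Slopes and desingularizers\<close>

text \<open>The derivative is available only on the open half-line. Concavity there reaches 0 by
  translating all points by \<epsilon> and letting \<epsilon> tend to 0.\<close>

lemma concave_on_atLeast_0:
  fixes \<phi> :: "real \<Rightarrow> real"
  assumes cont: "continuous_on {0..} \<phi>"
    and deriv: "\<And>t. t > 0 \<Longrightarrow> (\<phi> has_real_derivative \<phi>' t) (at t)"
    and anti: "\<And>s t. 0 < s \<Longrightarrow> s \<le> t \<Longrightarrow> \<phi>' t \<le> \<phi>' s"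
  shows "concave_on {0..} \<phi>"
proof -
  have conv: "convex_on {0<..} (\<lambda>t. - \<phi> t)"
  proof (rule convex_on_realI)
    show "((\<lambda>t. - \<phi> t) has_real_derivative - \<phi>' t) (at t)" if "t \<in> {0<..}" for t
      using DERIV_minus[OF deriv] that by simp
  qed (use anti in auto)
  have "convex_on {0..} (\<lambda>t. - \<phi> t)"
  proof (rule convex_onI)
    fix u x y :: real assume u: "0 < u" "u < 1" and xy: "x \<in> {0..}" "y \<in> {0..}"
    have lim: "((\<lambda>\<epsilon>. - \<phi> (z + \<epsilon>)) \<longlongrightarrow> - \<phi> z) (at_right 0)" if "z \<ge> 0" for z
    proof -
      have "continuous_on {0..} (\<lambda>\<epsilon>. \<phi> (z + \<epsilon>))"
        using that by (intro continuous_on_compose2[OF cont] continuous_intros) auto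
      then have "((\<lambda>\<epsilon>. \<phi> (z + \<epsilon>)) \<longlongrightarrow> \<phi> (z + 0)) (at 0 within {0..})"
        unfolding continuous_on_def by (rule bspec) simp
      then have "((\<lambda>\<epsilon>. \<phi> (z + \<epsilon>)) \<longlongrightarrow> \<phi> z) (at_right 0)"
        unfolding add_0_right by (rule tendsto_within_subset) auto
      then show ?thesis by (rule tendsto_minus)
    qed
    let ?z = "(1 - u) * x + u * y"
    have z: "?z \<ge> 0" using u xy by simp
    show "- \<phi> ((1 - u) *\<^sub>R x + u *\<^sub>R y) \<le> (1 - u) * - \<phi> x + u * - \<phi> y"
    proof (rule tendsto_le[OF trivial_limit_at_right_real])
      show "((\<lambda>\<epsilon>. (1 - u) * - \<phi> (x + \<epsilon>) + u * - \<phi> (y + \<epsilon>)) \<longlongrightarrow> (1 - u) * - \<phi> x + u * - \<phi> y) (at_right 0)"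
        using xy by (intro tendsto_intros lim) auto
      show "((\<lambda>\<epsilon>. - \<phi> (?z + \<epsilon>)) \<longlongrightarrow> - \<phi> ((1 - u) *\<^sub>R x + u *\<^sub>R y)) (at_right 0)"
        using lim[OF z] by simp
      show "\<forall>\<^sub>F \<epsilon> in at_right 0. - \<phi> (?z + \<epsilon>) \<le> (1 - u) * - \<phi> (x + \<epsilon>) + u * - \<phi> (y + \<epsilon>)"
        using eventually_at_right_less[of "0::real"]
      proof eventually_elim
        case (elim \<epsilon>)
        have "(1 - u) * (x + \<epsilon>) + u * (y + \<epsilon>) = ?z + \<epsilon>" by (simp add: algebra_simps)
        with convex_onD[OF conv, of u "x + \<epsilon>" "y + \<epsilon>"] u xy elim show ?case by simp
      qed
    qed
  qed simp
  then show ?thesis by (simp add: concave_on_def)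
qed

lemma increment_ge_deriv:
  fixes \<phi> :: "real \<Rightarrow> real"
  assumes "s < t" "continuous_on {s..t} \<phi>"
    and "\<And>u. s < u \<Longrightarrow> u < t \<Longrightarrow> (\<phi> has_real_derivative \<phi>' u) (at u)"
    and "\<And>u. s < u \<Longrightarrow> u < t \<Longrightarrow> c \<le> \<phi>' u"
  shows "c * (t - s) \<le> \<phi> t - \<phi> s"
proof -
  obtain l z where z: "s < z" "z < t" "(\<phi> has_real_derivative l) (at z)" "\<phi> t - \<phi> s = (t - s) * l"
    using MVT[OF assms(1,2)] assms(3) by (meson real_differentiable_def)
  have "l = \<phi>' z" using z(3) assms(3)[OF z(1,2)] by (rule DERIV_unique)
  then show ?thesis using z(4) assms(1) assms(4)[OF z(1,2)] by (simp add: mult.commute[of c] mult_left_mono)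
qed

lemma has_real_derivative_glue:
  fixes g h :: "real \<Rightarrow> real"
  assumes g: "(g has_real_derivative d) (at r)" and h: "(h has_real_derivative d) (at r)" and eq: "g r = h r"
  shows "((\<lambda>t. if t \<le> r then g t else h t) has_real_derivative d) (at r)"
proof -
  let ?f = "\<lambda>t. if t \<le> r then g t else h t"
  have "((\<lambda>y. (?f y - ?f r) / (y - r)) \<longlongrightarrow> d) (at_left r)"
  proof (rule Lim_transform_eventually)
    show "((\<lambda>y. (g y - g r) / (y - r)) \<longlongrightarrow> d) (at_left r)"
      using g unfolding has_field_derivative_iff by (simp add: filterlim_at_split)
    show "\<forall>\<^sub>F y in at_left r. (g y - g r) / (y - r) = (?f y - ?f r) / (y - r)"
      by (auto simp: eventually_at_filter)
  qed
  moreover have "((\<lambda>y. (?f y - ?f r) / (y - r)) \<longlongrightarrow> d) (at_right r)"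
  proof (rule Lim_transform_eventually)
    show "((\<lambda>y. (h y - h r) / (y - r)) \<longlongrightarrow> d) (at_right r)"
      using h unfolding has_field_derivative_iff by (simp add: filterlim_at_split)
    show "\<forall>\<^sub>F y in at_right r. (h y - h r) / (y - r) = (?f y - ?f r) / (y - r)"
      using eq by (auto simp: eventually_at_filter)
  qed
  ultimately show ?thesis unfolding has_field_derivative_iff by (simp add: filterlim_at_split)
qed

text \<open>These are the \<epsilon> entering the infimum that defines the slope of f at x, written
  over the reals so that the condition is first-order.\<close>

definition slope_bound :: "nat \<Rightarrow> real list set \<Rightarrow> (real list \<Rightarrow> real) \<Rightarrow> real list \<Rightarrow> real \<Rightarrow> bool" where
  "slope_bound n U f x \<epsilon> \<longleftrightarrow> x \<in> U \<and> \<epsilon> > 0 \<and>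
    (\<exists>r>0. \<forall>y\<in>U. euclidean_dist n x y < r \<longrightarrow> f x \<le> f y + \<epsilon> * euclidean_dist n x y)"

text \<open>These \<epsilon> form an up-set whose infimum is that of the slopes on the level.
  Arguing with the up-set avoids the infimum itself, which may be 0 or not attained.\<close>

definition level_slope_bound :: "nat \<Rightarrow> real list set \<Rightarrow> (real list \<Rightarrow> real) \<Rightarrow> real \<Rightarrow> real \<Rightarrow> bool" where
  "level_slope_bound n U f t \<epsilon> \<longleftrightarrow> (\<exists>x\<in>U. f x = t \<and> slope_bound n U f x \<epsilon>)"

lemma euclidean_dist_nonneg: "0 \<le> euclidean_dist n x y"
  by (simp add: euclidean_dist_def)

lemma level_slope_bound_mono:
  assumes "level_slope_bound n U f t \<epsilon>" "\<epsilon> \<le> \<delta>"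
  shows "level_slope_bound n U f t \<delta>"
proof -
  obtain x r where x: "x \<in> U" "f x = t" "\<epsilon> > 0" "r > 0"
    and r: "\<And>y. y \<in> U \<Longrightarrow> euclidean_dist n x y < r \<Longrightarrow> f x \<le> f y + \<epsilon> * euclidean_dist n x y"
    using assms(1) unfolding level_slope_bound_def slope_bound_def by blast
  have "f x \<le> f y + \<delta> * euclidean_dist n x y" if "y \<in> U" "euclidean_dist n x y < r" for y
    using r[OF that] mult_right_mono[OF assms(2) euclidean_dist_nonneg[of n x y]] by linarith
  moreover have "\<delta> > 0" using x(3) assms(2) by linarith
  ultimately show ?thesis unfolding level_slope_bound_def slope_bound_def using x by blast
qed

text \<open>At a point where \<open>\<phi> \<circ> f\<close> has slope bound \<open>\<epsilon>\<close>, the tangent inequality for the concave \<open>\<phi>\<close>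
  gives \<open>f\<close> the slope bound \<open>\<epsilon> / \<phi>' t\<close>.\<close>

lemma slope_desingularized_ge_1:
  assumes zero: "\<phi> 0 = 0" and pos: "0 < t" "0 < \<phi>' t"
    and tangent: "\<And>s. 0 \<le> s \<Longrightarrow> s < t \<Longrightarrow> \<phi>' t * (t - s) \<le> \<phi> t - \<phi> s"
    and bound: "\<And>\<epsilon>. level_slope_bound n U f t \<epsilon> \<Longrightarrow> 1 \<le> \<epsilon> * \<phi>' t"
    and x: "x \<in> U" "f x = t"
  shows "1 \<le> slope U (euclidean_dist n) (\<lambda>y. ereal (zero_ext \<phi> (f y))) x"
  unfolding slope_def
proof (rule Inf_greatest)
  fix z assume "z \<in> {ereal \<epsilon> | \<epsilon>. \<epsilon> > 0 \<and>
    local_minimizer U (euclidean_dist n) (\<lambda>y. ereal (zero_ext \<phi> (f y)) + ereal (\<epsilon> * euclidean_dist n x y)) x}"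
  then obtain \<epsilon> r where \<epsilon>: "z = ereal \<epsilon>" "\<epsilon> > 0" "r > 0"
    and r: "\<And>y. y \<in> U \<Longrightarrow> euclidean_dist n x y < r \<Longrightarrow>
      zero_ext \<phi> (f x) + \<epsilon> * euclidean_dist n x x \<le> zero_ext \<phi> (f y) + \<epsilon> * euclidean_dist n x y"
    unfolding local_minimizer_def by auto
  have "0 < \<phi>' t * (t - 0)" using pos by simp
  also have "\<dots> \<le> \<phi> t - \<phi> 0" using pos by (intro tangent) auto
  finally have \<phi>t: "\<phi> t > 0" using zero by simp
  have dxx: "euclidean_dist n x x = 0" by (simp add: euclidean_dist_def L2_set_def)
  \<comment> \<open>Within distance \<open>\<phi> t / \<epsilon>\<close> the perturbation is smaller
    than \<open>\<phi> t\<close>, so a point with \<open>f y < 0\<close>, where the extension of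
    \<phi> is 0, would contradict local minimality.\<close>
  define r' where "r' = min r (\<phi> t / \<epsilon>)"
  have "f x \<le> f y + \<epsilon> / \<phi>' t * euclidean_dist n x y"
    if y: "y \<in> U" "euclidean_dist n x y < r'" for y
  proof -
    let ?d = "euclidean_dist n x y"
    have "?d < r" "?d < \<phi> t / \<epsilon>" using y(2) by (auto simp: r'_def)
    then have d: "\<epsilon> * ?d < \<phi> t" using \<epsilon>(2) by (simp add: pos_less_divide_eq mult.commute)
    have le: "\<phi> t \<le> zero_ext \<phi> (f y) + \<epsilon> * ?d"
      using r[OF y(1) \<open>?d < r\<close>] x(2) pos(1) dxx by (simp add: zero_ext_def)
    have nonneg: "0 \<le> \<epsilon> / \<phi>' t * ?d" using \<epsilon>(2) pos(2) euclidean_dist_nonneg[of n x y] by simp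
    consider "f y < 0" | "0 \<le> f y" "f y < t" | "t \<le> f y" by linarith
    then show ?thesis
    proof cases
      case 1
      then show ?thesis using le d by (simp add: zero_ext_def)
    next
      case 2
      then have "\<phi>' t * (t - f y) \<le> \<epsilon> * ?d" using le tangent[OF 2] by (simp add: zero_ext_def)
      then have "t - f y \<le> \<epsilon> * ?d / \<phi>' t" using pos(2) by (simp add: pos_le_divide_eq mult.commute)
      then show ?thesis using x(2) by simp
    next
      case 3
      then show ?thesis using nonneg x(2) by linarith
    qed
  qed
  moreover have "r' > 0" using \<epsilon> \<phi>t by (simp add: r'_def)
  moreover have "\<epsilon> / \<phi>' t > 0" using \<epsilon>(2) pos(2) by simp
  ultimately have "level_slope_bound n U f t (\<epsilon> / \<phi>' t)"
    unfolding level_slope_bound_def slope_bound_def using x by blast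
  from bound[OF this] show "1 \<le> z" using pos(2) \<epsilon>(1) by (simp add: one_ereal_def)
qed

section \<open>A criterion for desingularizers, and definability of slope bounds\<close>

context o_minimal_real_field_expansion
begin

lemma definable_set2:
  assumes "definable (\<lambda>e. R (e 0) (e (Suc 0)))"
  shows "{[x, y] | x y. R x y} \<in> S 2"
proof -
  obtain N A where A: "A \<in> S N" "\<And>e. R (e 0) (e (Suc 0)) \<longleftrightarrow> map e [0..<N] \<in> A"
    using assms unfolding definable_def by blast
  \<comment> \<open>R ignores the variables beyond 1, so all of them may be read off coordinate
    1.\<close>
  let ?js = "map (\<lambda>i. min i (Suc 0)) [0..<N]"
  have "{xs \<in> Rn 2. map ((!) xs) ?js \<in> A} \<in> S 2"
    using A(1) by (intro reindex) auto
  also have "{xs \<in> Rn 2. map ((!) xs) ?js \<in> A} = {[x, y] | x y. R x y}"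
  proof -
    have "R x y \<longleftrightarrow> map ((!) [x, y]) ?js \<in> A" for x y
      using A(2)[of "\<lambda>i. [x, y] ! min i (Suc 0)"] by (simp add: comp_def)
    then show ?thesis by (auto simp: Rn_def length_Suc_conv numeral_2_eq_2)
  qed
  finally show ?thesis .
qed

text \<open>Both constructions below end here: what they have to provide is a nonincreasing positive
  derivative that is at least the reciprocal of every slope bound on the level.\<close>

lemma desingularizer_conclusion:
  assumes "\<phi> 0 = 0" "continuous_on {0..} \<phi>"
    and deriv: "\<And>t. t > 0 \<Longrightarrow> (\<phi> has_real_derivative \<phi>' t) (at t)"
    and "continuous_on {0<..} \<phi>'"
    and pos: "\<And>t. t > 0 \<Longrightarrow> 0 < \<phi>' t"
    and anti: "\<And>s t. 0 < s \<Longrightarrow> s \<le> t \<Longrightarrow> \<phi>' t \<le> \<phi>' s"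
    and def: "definable_term (\<lambda>e. \<phi> (e 0))"
    and "0 < \<rho>"
    and bound: "\<And>t \<epsilon>. 0 < t \<Longrightarrow> t < \<rho> \<Longrightarrow> level_slope_bound n U f t \<epsilon> \<Longrightarrow> 1 \<le> \<epsilon> * \<phi>' t"
  shows "\<exists>\<phi> \<rho>. desingularizer \<phi> \<and> concave_on {0..} \<phi> \<and> definable_on_nonneg S \<phi> \<and> \<rho> > 0 \<and>
    (\<forall>x\<in>U. 0 < f x \<and> f x < \<rho> \<longrightarrow>
      slope U (euclidean_dist n) (\<lambda>y. ereal (zero_ext \<phi> (f y))) x \<ge> 1)"
proof (intro exI[of _ \<phi>] exI[of _ \<rho>] conjI ballI impI)
  have tangent: "\<phi>' t * (t - s) \<le> \<phi> t - \<phi> s" if "0 \<le> s" "s < t" for s t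
  proof (rule increment_ge_deriv[where \<phi>'=\<phi>', OF that(2)])
    show "continuous_on {s..t} \<phi>" using assms(2) by (rule continuous_on_subset) (use that in auto)
  qed (use deriv anti that in auto)
  have "\<phi> t \<ge> 0" if "t \<ge> 0" for t
  proof (cases "t = 0")
    case False
    then have "0 < \<phi>' t * (t - 0)" using pos that by simp
    also have "\<dots> \<le> \<phi> t - \<phi> 0" using False that by (intro tangent) auto
    finally show ?thesis using assms(1) by simp
  qed (simp add: assms(1))
  then show "desingularizer \<phi>" unfolding desingularizer_def using assms by blast
  show "concave_on {0..} \<phi>" using assms(2) deriv anti by (rule concave_on_atLeast_0)
  have "{[t, s] | t s. 0 \<le> t \<and> s = \<phi> t} \<in> S 2"
    by (intro definable_set2 definable_intros def[THEN definable_term_comp1])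
  moreover have "{[t, s] | t s. 0 \<le> t \<and> s = \<phi> t} = {[t, \<phi> t] | t. t \<ge> 0}" by blast
  ultimately show "definable_on_nonneg S \<phi>" unfolding definable_on_nonneg_def by simp
  show "0 < \<rho>" by fact
  fix x assume "x \<in> U" "0 < f x \<and> f x < \<rho>"
  then show "1 \<le> slope U (euclidean_dist n) (\<lambda>y. ereal (zero_ext \<phi> (f y))) x"
    using assms(1) pos tangent bound by (intro slope_desingularized_ge_1[where t="f x" and \<phi>'=\<phi>']) auto
qed

lemma definable_term_euclidean_dist:
  assumes "\<And>i. definable_term (\<lambda>e. u i e)" "\<And>i. definable_term (\<lambda>e. v i e)"
  shows "definable_term (\<lambda>e. euclidean_dist n (map (\<lambda>i. u i e) [0..<n]) (map (\<lambda>i. v i e) [0..<n]))"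
proof -
  have "definable_term (\<lambda>e. sqrt (\<Sum>i<n. (u i e - v i e) * (u i e - v i e)))"
    by (intro definable_term_sqrt definable_term_sum definable_intros assms)
  then show ?thesis by (simp add: euclidean_dist_def L2_set_def power2_eq_square)
qed

lemma definable_slope_bound:
  assumes U: "U \<in> S n" and f: "definable_fun S n U f"
  shows "(\<And>i. definable_term (\<lambda>e. u i e)) \<Longrightarrow> definable_term w \<Longrightarrow>
      definable (\<lambda>e. map (\<lambda>i. u i e) [0..<n] \<in> U \<and> f (map (\<lambda>i. u i e) [0..<n]) = w e)"
    and "(\<And>i. definable_term (\<lambda>e. u i e)) \<Longrightarrow> definable_term w \<Longrightarrow>
      definable (\<lambda>e. slope_bound n U f (map (\<lambda>i. u i e) [0..<n]) (w e))"
    and "definable_term v \<Longrightarrow> definable_term w \<Longrightarrow> definable (\<lambda>e. level_slope_bound n U f (v e) (w e))"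
proof -
  let ?\<Gamma> = "{xs @ [f xs] | xs. xs \<in> U}"
  have U': "U \<subseteq> Rn n" using subset_Rn[OF U] .
  have \<Gamma>: "?\<Gamma> \<in> S (Suc n)" using f by (simp add: definable_fun_def)
  have graph: "definable (\<lambda>e. map (\<lambda>i. u i e) [0..<n] \<in> U \<and> f (map (\<lambda>i. u i e) [0..<n]) = w e)"
    if "\<And>i. definable_term (\<lambda>e. u i e)" "definable_term w" for u w
  proof -
    have "definable_term (\<lambda>e. if i < n then u i e else w e)" for i
      using that by (intro definable_term_if definable_const) auto
    from definable_mem[OF \<Gamma> this]
    have "definable (\<lambda>e. map (\<lambda>i. if i < n then u i e else w e) [0..<Suc n] \<in> ?\<Gamma>)" .
    moreover have "map (\<lambda>i. if i < n then u i e else w e) [0..<Suc n] = map (\<lambda>i. u i e) [0..<n] @ [w e]" for e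
      unfolding upt_Suc_append[OF le0] map_append by (intro arg_cong2[where f="(@)"] map_cong) auto
    moreover have "map (\<lambda>i. u i e) [0..<n] @ [w e] \<in> ?\<Gamma> \<longleftrightarrow>
        map (\<lambda>i. u i e) [0..<n] \<in> U \<and> f (map (\<lambda>i. u i e) [0..<n]) = w e" for e
      by auto
    ultimately show ?thesis by (simp only:)
  qed
  then show "(\<And>i. definable_term (\<lambda>e. u i e)) \<Longrightarrow> definable_term w \<Longrightarrow>
      definable (\<lambda>e. map (\<lambda>i. u i e) [0..<n] \<in> U \<and> f (map (\<lambda>i. u i e) [0..<n]) = w e)" .
  \<comment> \<open>The graph of f is given over U only; the extension by 0 is total and may be used
    as a term.\<close>
  define F where "F xs = (if xs \<in> U then f xs else 0)" for xs
  have F: "definable_term (\<lambda>e. F (map (\<lambda>i. u i e) [0..<n]))" if "\<And>i. definable_term (\<lambda>e. u i e)" for u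
  proof -
    have "definable_term (\<lambda>e. F (map e [0..<n]))"
    proof (rule definable_termI)
      show "t = F (map e [0..<n]) \<longleftrightarrow> (map e [0..<n] \<in> U \<and> f (map e [0..<n]) = t) \<or> (\<not> map e [0..<n] \<in> U \<and> t = 0)"
        for t e by (auto simp: F_def)
    qed (intro definable_disj definable_conj[OF definable_not] graph definable_intros U)
    from definable_term_comp[OF this that] show ?thesis .
  qed
  have slope: "definable (\<lambda>e. slope_bound n U f (map (\<lambda>i. u i e) [0..<n]) (w e))"
    if u: "\<And>i. definable_term (\<lambda>e. u i e)" and w: "definable_term w" for u w
  proof -
    have "slope_bound n U f x \<epsilon> \<longleftrightarrow> x \<in> U \<and> \<epsilon> > 0 \<and>
      (\<exists>r. r > 0 \<and> (\<forall>y\<in>Rn n. y \<in> U \<longrightarrow> euclidean_dist n x y < r \<longrightarrow> F x \<le> F y + \<epsilon> * euclidean_dist n x y))" for x \<epsilon>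
      using U' unfolding slope_bound_def F_def by (auto; blast)
    moreover have "definable (\<lambda>e. map (\<lambda>i. e (Suc i)) [0..<n] \<in> U \<and> e 0 > 0 \<and>
      (\<exists>r. r > 0 \<and> (\<forall>y\<in>Rn n. y \<in> U \<longrightarrow> euclidean_dist n (map (\<lambda>i. e (Suc i)) [0..<n]) y < r \<longrightarrow>
        F (map (\<lambda>i. e (Suc i)) [0..<n]) \<le> F y + e 0 * euclidean_dist n (map (\<lambda>i. e (Suc i)) [0..<n]) y)))"
      by (intro definable_intros definable_term_euclidean_dist F U)
    ultimately have *: "definable (\<lambda>e. slope_bound n U f (map (\<lambda>i. e (Suc i)) [0..<n]) (e 0))" by simp
    have "definable_term (case_nat w u i)" for i using u w by (cases i) auto
    from definable_comp[where u="case_nat w u", OF * this] show ?thesis by simp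
  qed
  then show "(\<And>i. definable_term (\<lambda>e. u i e)) \<Longrightarrow> definable_term w \<Longrightarrow>
      definable (\<lambda>e. slope_bound n U f (map (\<lambda>i. u i e) [0..<n]) (w e))" .
  have "definable (\<lambda>e. level_slope_bound n U f (e 0) (e (Suc 0)))"
  proof -
    have "level_slope_bound n U f t \<epsilon> \<longleftrightarrow> (\<exists>x\<in>Rn n. (x \<in> U \<and> f x = t) \<and> slope_bound n U f x \<epsilon>)" for t \<epsilon>
      using U' unfolding level_slope_bound_def by blast
    moreover have "definable (\<lambda>e. \<exists>x\<in>Rn n. (x \<in> U \<and> f x = e 0) \<and> slope_bound n U f x (e (Suc 0)))"
      by (intro definable_ex_vec definable_conj[OF graph slope] definable_term_var)
    ultimately show ?thesis by simp
  qed
  then show "definable_term v \<Longrightarrow> definable_term w \<Longrightarrow> definable (\<lambda>e. level_slope_bound n U f (v e) (w e))"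
    by (rule definable_comp2)
qed

text \<open>A slope bound \<open>\<epsilon>\<close> that is at most \<open>t\<close> or cannot be halved serves as a quasi-minimal one; the
  first alternative takes the place of the case that the infimum of the slopes on the level is zero.\<close>

lemma quasi_minimal_slope_bound:
  assumes "0 < t" "level_slope_bound n U f t \<epsilon>"
  shows "\<exists>\<epsilon>. level_slope_bound n U f t \<epsilon> \<and> (\<epsilon> \<le> t \<or> \<not> level_slope_bound n U f t (1 / 2 * \<epsilon>))"
proof (rule ccontr)
  assume "\<not> ?thesis"
  \<comment> \<open>Otherwise a bound could be halved forever while staying above t.\<close>
  then have *: "t < \<delta> \<and> level_slope_bound n U f t (1 / 2 * \<delta>)" if "level_slope_bound n U f t \<delta>" for \<delta>
    using that by (meson not_le)
  have "level_slope_bound n U f t ((1 / 2) ^ k * \<epsilon>)" for k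
  proof (induction k)
    case (Suc k)
    then show ?case using *[OF Suc.IH] by (simp add: mult.assoc)
  qed (use assms(2) in simp)
  then have lt: "t < (1 / 2) ^ k * \<epsilon>" for k using * by blast
  have "(\<lambda>k. (1 / 2) ^ k * \<epsilon>) \<longlonglongrightarrow> 0 * \<epsilon>"
    by (intro tendsto_intros LIMSEQ_power_zero) simp
  then have "\<forall>\<^sub>F k in sequentially. (1 / 2) ^ k * \<epsilon> < t"
    using assms(1) by (intro order_tendstoD(2)) auto
  then show False using lt by (meson eventually_happens' less_asym sequentially_bot)
qed

text \<open>The speed of a curve crossing the levels of \<open>f\<close>, bounded by the derivative of \<open>g\<close>,
  is at least the reciprocal of the slope.\<close>

lemma slope_bound_along_curve:
  assumes bound: "slope_bound n U f (c t) \<epsilon>" and "s0 < t"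
    and c: "\<And>s. s0 < s \<Longrightarrow> s \<le> t \<Longrightarrow> c s \<in> U \<and> f (c s) = s"
    and dist: "\<And>s. s0 < s \<Longrightarrow> s \<le> t \<Longrightarrow> euclidean_dist n (c t) (c s) \<le> g t - g s"
    and deriv: "(g has_real_derivative D) (at t)"
  shows "1 \<le> \<epsilon> * D"
proof -
  obtain r where \<epsilon>: "\<epsilon> > 0" "r > 0" and r: "\<And>y. y \<in> U \<Longrightarrow> euclidean_dist n (c t) y < r \<Longrightarrow>
      f (c t) \<le> f y + \<epsilon> * euclidean_dist n (c t) y"
    using bound unfolding slope_bound_def by blast
  \<comment> \<open>Continuity of g brings the curve into the ball of radius r, since g dominates
    the increments of the curve.\<close>
  have "isCont g t" using deriv by (rule DERIV_isCont)
  then have "((\<lambda>s. g t - g s) \<longlongrightarrow> g t - g t) (at_left t)"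
    unfolding continuous_at by (intro tendsto_diff tendsto_const) (simp add: filterlim_at_split)
  then have "\<forall>\<^sub>F s in at_left t. g t - g s < r"
    by (rule order_tendstoD) (use \<epsilon>(2) in simp)
  moreover have "\<forall>\<^sub>F s in at_left t. s0 < s \<and> s < t"
    unfolding eventually_at_left_field using assms(2) by blast
  ultimately have "\<forall>\<^sub>F s in at_left t. 1 \<le> \<epsilon> * ((g s - g t) / (s - t))"
  proof eventually_elim
    case (elim s)
    then have s: "c s \<in> U" "f (c s) = s" "euclidean_dist n (c t) (c s) \<le> g t - g s" "f (c t) = t"
      using c[of s] c[of t] dist[of s] by auto
    then have "t \<le> s + \<epsilon> * euclidean_dist n (c t) (c s)" using r[of "c s"] elim(1) by simp
    also have "\<dots> \<le> s + \<epsilon> * (g t - g s)" using s(3) \<epsilon>(1) by simp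
    finally have "1 \<le> \<epsilon> * (g t - g s) / (t - s)" using elim(2) by (simp add: pos_le_divide_eq)
    then show ?case using minus_divide_divide[of "g t - g s" "t - s"] by simp
  qed
  moreover have "((\<lambda>s. \<epsilon> * ((g s - g t) / (s - t))) \<longlongrightarrow> \<epsilon> * D) (at_left t)"
    using deriv unfolding has_field_derivative_iff
    by (intro tendsto_mult tendsto_const) (simp add: filterlim_at_split)
  ultimately show ?thesis using tendsto_lowerbound trivial_limit_at_left_real by blast
qed

text \<open>The second alternative is the aim; the first stems from levels where the selected slope
  bound is at most t, and is excluded later for small t. Differentiability is assumed in the
  estimate because \<open>germ_C1\<close> supplies it separately.\<close>

lemma level_curve:
  assumes U: "U \<in> S n" and f: "definable_fun S n U f"
    and bounded: "\<And>x i. x \<in> U \<Longrightarrow> i < n \<Longrightarrow> \<bar>x ! i\<bar> \<le> m"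
    and nonempty: "\<forall>\<^sub>F t in at_right 0. \<exists>\<epsilon>. level_slope_bound n U f t \<epsilon>"
  obtains b g where "0 < b" "definable_term (\<lambda>e. g (e 0))" "mono_on {0<..<b} g"
    "\<And>t. 0 < t \<Longrightarrow> t < b \<Longrightarrow> - (real n * m) \<le> g t"
    "\<And>t D \<epsilon>. 0 < t \<Longrightarrow> t < b \<Longrightarrow> (g has_real_derivative D) (at t) \<Longrightarrow> level_slope_bound n U f t \<epsilon> \<Longrightarrow>
      1 \<le> t * D \<or> 1 \<le> 2 * \<epsilon> * D"
proof -
  note sb = definable_slope_bound[OF U f]
  \<comment> \<open>The slope bound is quantified away: only the point is chosen, so the boundedness
    of U supplies the lower bound that definable choice asks for.\<close>
  define P where "P t x \<longleftrightarrow> (x \<in> U \<and> f x = t) \<and>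
    (\<exists>\<epsilon>. slope_bound n U f x \<epsilon> \<and> (\<epsilon> \<le> t \<or> \<not> level_slope_bound n U f t (1 / 2 * \<epsilon>)))" for t x
  have "definable (\<lambda>e. P (e 0) (map (\<lambda>i. e (Suc i)) [0..<n]))"
    unfolding P_def by (intro definable_conj[OF sb(1)] definable_ex definable_conj[OF sb(2)] definable_disj
      definable_not sb(3) definable_le definable_term_mult definable_term_var definable_term_const)
  moreover have "- m \<le> y ! i" if "P t y" "i < n" for t y i
    using that bounded[of y i] unfolding P_def by linarith
  ultimately obtain X where X: "\<And>i. definable_term (\<lambda>e. X i (e 0))"
    "\<And>t. (\<exists>y\<in>Rn n. P t y) \<Longrightarrow> P t (map (\<lambda>i. X i t) [0..<n])"
    using definable_choice[of P n "- m"] by blast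
  define c where "c t = map (\<lambda>i. X i t) [0..<n]" for t
  obtain a where a: "0 < a" "\<And>t. 0 < t \<Longrightarrow> t < a \<Longrightarrow> \<exists>\<epsilon>. level_slope_bound n U f t \<epsilon>"
    using nonempty unfolding eventually_at_right_field by blast
  have Pc: "P t (c t)" if t: "0 < t" "t < a" for t
  proof -
    obtain \<epsilon> where "level_slope_bound n U f t \<epsilon>" "\<epsilon> \<le> t \<or> \<not> level_slope_bound n U f t (1 / 2 * \<epsilon>)"
      using quasi_minimal_slope_bound[OF t(1)] a(2)[OF t] by blast
    then have "\<exists>y\<in>Rn n. P t y"
      using subset_Rn[OF U] unfolding P_def level_slope_bound_def by blast
    then show ?thesis unfolding c_def by (rule X(2))
  qed
  have "\<forall>\<^sub>F b in at_right 0. \<forall>i\<in>{..<n}. mono_on {0<..<b} (X i) \<or> antimono_on {0<..<b} (X i)"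
  proof (rule eventually_ball_finite)
    show "\<forall>i\<in>{..<n}. \<forall>\<^sub>F b in at_right 0. mono_on {0<..<b} (X i) \<or> antimono_on {0<..<b} (X i)"
    proof
      fix i
      obtain b where b: "b > 0" "mono_on {0<..<b} (X i) \<or> antimono_on {0<..<b} (X i)"
        using germ_monotone[OF X(1), of 0] by blast
      have "mono_on {0<..<b'} (X i) \<or> antimono_on {0<..<b'} (X i)" if "b' < b" for b'
      proof -
        have "{0<..<b'} \<subseteq> {0<..<b}" using that by auto
        then show ?thesis using b(2) monotone_on_subset by blast
      qed
      then show "\<forall>\<^sub>F b in at_right 0. mono_on {0<..<b} (X i) \<or> antimono_on {0<..<b} (X i)"
        unfolding eventually_at_right_field using b(1) by blast
    qed
  qed simp
  moreover have "\<forall>\<^sub>F b in at_right 0. 0 < b \<and> b < a"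
    unfolding eventually_at_right_field using a(1) by blast
  ultimately have "\<forall>\<^sub>F b in at_right 0. (\<forall>i\<in>{..<n}. mono_on {0<..<b} (X i) \<or> antimono_on {0<..<b} (X i))
      \<and> (0 < b \<and> b < a)"
    by (rule eventually_conj)
  then obtain b where b: "0 < b" "b < a"
    "\<And>i. i < n \<Longrightarrow> mono_on {0<..<b} (X i) \<or> antimono_on {0<..<b} (X i)"
    using eventually_happens'[OF trivial_limit_at_right_real] by blast
  \<comment> \<open>With these signs all coordinates increase, so for s \<le> t the difference
    \<open>g t - g s\<close> is the L1 distance between \<open>c s\<close> and
    \<open>c t\<close>.\<close>
  define \<sigma> where "\<sigma> i = (if mono_on {0<..<b} (X i) then 1 else - 1 :: real)" for i
  define g where "g t = (\<Sum>i<n. \<sigma> i * X i t)" for t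
  have \<sigma>: "\<sigma> i * X i s \<le> \<sigma> i * X i t" if "i < n" "0 < s" "s \<le> t" "t < b" for i s t
    using b(3)[OF that(1)] that unfolding \<sigma>_def monotone_on_def by auto
  have g_mono: "mono_on {0<..<b} g"
    unfolding g_def by (intro mono_onI sum_mono \<sigma>) auto
  have g_lower: "- (real n * m) \<le> g t" if "0 < t" "t < b" for t
  proof -
    have "c t \<in> U" using Pc[of t] that b(2) unfolding P_def by auto
    then have "- m \<le> \<sigma> i * X i t" if "i < n" for i
      using bounded[of "c t" i] that unfolding c_def \<sigma>_def by auto
    then have "(\<Sum>i<n. - m) \<le> g t" unfolding g_def by (intro sum_mono) auto
    then show ?thesis by simp
  qed
  have "definable_term (\<lambda>e. g (e 0))"
    unfolding g_def by (intro definable_term_sum definable_intros X(1))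
  moreover have "1 \<le> t * D \<or> 1 \<le> 2 * \<epsilon> * D"
    if t: "0 < t" "t < b" and D: "(g has_real_derivative D) (at t)" and \<epsilon>: "level_slope_bound n U f t \<epsilon>" for t D \<epsilon>
  proof -
    obtain \<delta> where \<delta>: "slope_bound n U f (c t) \<delta>" "\<delta> \<le> t \<or> \<not> level_slope_bound n U f t (1 / 2 * \<delta>)"
      using Pc[of t] t b(2) unfolding P_def by auto
    have \<delta>pos: "\<delta> > 0" using \<delta>(1) unfolding slope_bound_def by blast
    have \<delta>D: "1 \<le> \<delta> * D"
    proof (rule slope_bound_along_curve[where c=c and g=g, OF \<delta>(1) t(1) _ _ D])
      fix s assume s: "0 < s" "s \<le> t"
      show "c s \<in> U \<and> f (c s) = s" using Pc[of s] s t b(2) unfolding P_def by auto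
      have "euclidean_dist n (c t) (c s) \<le> (\<Sum>i<n. \<bar>c t ! i - c s ! i\<bar>)"
        unfolding euclidean_dist_def by (rule L2_set_le_sum_abs)
      also have "\<dots> \<le> (\<Sum>i<n. \<sigma> i * X i t - \<sigma> i * X i s)"
      proof (rule sum_mono)
        fix i assume "i \<in> {..<n}"
        then show "\<bar>c t ! i - c s ! i\<bar> \<le> \<sigma> i * X i t - \<sigma> i * X i s"
          using \<sigma>[of i s t] s t unfolding c_def \<sigma>_def by (auto split: if_splits)
      qed
      also have "\<dots> = g t - g s" unfolding g_def by (simp add: sum_subtractf)
      finally show "euclidean_dist n (c t) (c s) \<le> g t - g s" .
    qed
    then have "0 < \<delta> * D" by linarith
    then have Dpos: "D > 0" using \<delta>pos by (simp add: zero_less_mult_iff)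
    \<comment> \<open>Either the selected bound is at most t, or half of it fails; as bounds are
      upward closed, every bound on the level then exceeds that half.\<close>
    from \<delta>(2) show ?thesis
    proof
      assume "\<delta> \<le> t"
      then have "\<delta> * D \<le> t * D" using Dpos by simp
      then show ?thesis using \<delta>D by linarith
    next
      assume "\<not> level_slope_bound n U f t (1 / 2 * \<delta>)"
      then have "1 / 2 * \<delta> < \<epsilon>" using level_slope_bound_mono[OF \<epsilon>, of "1 / 2 * \<delta>"] by (meson not_le)
      then have "\<delta> * D \<le> 2 * \<epsilon> * D" using Dpos by simp
      then show ?thesis using \<delta>D by linarith
    qed
  qed
  ultimately show ?thesis using that b(1) g_mono g_lower by blast
qed

section \<open>Linear and concave desingularizers\<close>

lemma linear_desingularizer:
  assumes "0 < C" "0 < \<rho>"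
    and "\<And>t \<epsilon>. 0 < t \<Longrightarrow> t < \<rho> \<Longrightarrow> level_slope_bound n U f t \<epsilon> \<Longrightarrow> 1 \<le> \<epsilon> * C"
  shows "\<exists>\<phi> \<rho>. desingularizer \<phi> \<and> concave_on {0..} \<phi> \<and> definable_on_nonneg S \<phi> \<and> \<rho> > 0 \<and>
    (\<forall>x\<in>U. 0 < f x \<and> f x < \<rho> \<longrightarrow>
      slope U (euclidean_dist n) (\<lambda>y. ereal (zero_ext \<phi> (f y))) x \<ge> 1)"
proof (rule desingularizer_conclusion[where \<phi>="\<lambda>t. C * t" and \<phi>'="\<lambda>_. C" and \<rho>=\<rho>])
  show "((\<lambda>t. C * t) has_real_derivative C) (at t)" for t
    by (auto intro!: derivative_eq_intros)
  show "definable_term (\<lambda>e. C * e 0)" by (intro definable_intros)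
qed (use assms in \<open>auto intro!: continuous_intros\<close>)

text \<open>Concavity refutes the alternative \<open>1 \<le> t * D t\<close> for small t: the
  tangent at t gives \<open>t * D t \<le> g t - g0\<close>, and \<open>g0\<close> is the limit of g
  at 0. The other alternative says that twice the derivative of g is steep enough.\<close>

lemma concave_desingularizer:
  assumes g: "definable_term (\<lambda>e. g (e 0))" and "0 < b"
    and mono: "mono_on {0<..<b} g" and lower: "\<And>t. 0 < t \<Longrightarrow> t < b \<Longrightarrow> m \<le> g t"
    and deriv: "\<And>t. 0 < t \<Longrightarrow> t < b \<Longrightarrow> (g has_real_derivative D t) (at t)"
    and cont: "continuous_on {0<..<b} D" and anti: "antimono_on {0<..<b} D"
    and bound: "\<And>t \<epsilon>. 0 < t \<Longrightarrow> t < b \<Longrightarrow> level_slope_bound n U f t \<epsilon> \<Longrightarrow> 1 \<le> t * D t \<or> 1 \<le> 2 * \<epsilon> * D t"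
  shows "\<exists>\<phi> \<rho>. desingularizer \<phi> \<and> concave_on {0..} \<phi> \<and> definable_on_nonneg S \<phi> \<and> \<rho> > 0 \<and>
    (\<forall>x\<in>U. 0 < f x \<and> f x < \<rho> \<longrightarrow>
      slope U (euclidean_dist n) (\<lambda>y. ereal (zero_ext \<phi> (f y))) x \<ge> 1)"
proof -
  \<comment> \<open>By monotonicity this is the right limit at 0, and it is finite because g is
    bounded below.\<close>
  define g0 where "g0 = Inf (g ` {0<..<b})"
  have bdd: "bdd_below (g ` {0<..<b})" using lower by (intro bdd_belowI[of _ m]) auto
  have ne: "g ` {0<..<b} \<noteq> {}" using \<open>0 < b\<close> by simp
  have ge: "g0 \<le> g t" if "0 < t" "t < b" for t
    unfolding g0_def using that bdd by (intro cInf_lower) auto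
  have lim: "(g \<longlongrightarrow> g0) (at_right 0)"
  proof (rule order_tendstoI)
    fix y assume "y < g0"
    moreover have "\<forall>\<^sub>F t in at_right 0. 0 < t \<and> t < b"
      unfolding eventually_at_right_field using \<open>0 < b\<close> by blast
    ultimately show "\<forall>\<^sub>F t in at_right 0. y < g t"
      by (auto elim!: eventually_mono dest: ge)
  next
    fix y assume "g0 < y"
    then obtain s where s: "0 < s" "s < b" "g s < y"
      unfolding g0_def cInf_less_iff[OF ne bdd] by auto
    have "g t < y" if "0 < t" "t < s" for t
      using mono_onD[OF mono, of t s] that s by auto
    then show "\<forall>\<^sub>F t in at_right 0. g t < y"
      unfolding eventually_at_right_field using s(1) by blast
  qed
  have anti': "D t \<le> D s" if "0 < s" "s \<le> t" "t < b" for s t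
    using anti that unfolding monotone_on_def by auto
  have tD: "t * D t \<le> g t - g0" if t: "0 < t" "t < b" for t
  proof (rule tendsto_le[OF trivial_limit_at_right_real])
    show "((\<lambda>s. g t - g s) \<longlongrightarrow> g t - g0) (at_right 0)" by (intro tendsto_intros lim)
    have "((\<lambda>s. D t * (t - s)) \<longlongrightarrow> D t * (t - 0)) (at_right 0)" by (intro tendsto_intros)
    then show "((\<lambda>s. D t * (t - s)) \<longlongrightarrow> t * D t) (at_right 0)" by (simp add: mult.commute)
    have "D t * (t - s) \<le> g t - g s" if s: "0 < s" "s < t" for s
    proof (rule increment_ge_deriv[where \<phi>'=D, OF s(2)])
      show "continuous_on {s..t} g"
        using s t by (intro continuous_at_imp_continuous_on ballI DERIV_isCont[OF deriv]) auto
    qed (use deriv anti' s t in auto)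
    then show "\<forall>\<^sub>F s in at_right 0. D t * (t - s) \<le> g t - g s"
      unfolding eventually_at_right_field using t(1) by blast
  qed
  have Dnonneg: "0 \<le> D t" if t: "0 < t" "t < b" for t
  proof (rule tendsto_lowerbound)
    show "((\<lambda>y. (g y - g t) / (y - t)) \<longlongrightarrow> D t) (at_right t)"
      using deriv[OF t] unfolding has_field_derivative_iff by (simp add: filterlim_at_split)
    have "0 \<le> (g y - g t) / (y - t)" if "t < y" "y < b" for y
      using mono_onD[OF mono, of t y] that t by simp
    then show "\<forall>\<^sub>F y in at_right t. 0 \<le> (g y - g t) / (y - t)"
      unfolding eventually_at_right_field using t(2) by blast
  qed simp
  have "\<forall>\<^sub>F t in at_right 0. g t < g0 + 1" by (rule order_tendstoD[OF lim]) simp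
  moreover have "\<forall>\<^sub>F t in at_right 0. 0 < t \<and> t < b"
    unfolding eventually_at_right_field using \<open>0 < b\<close> by blast
  ultimately have "\<forall>\<^sub>F t in at_right 0. g t < g0 + 1 \<and> 0 < t \<and> t < b" by (rule eventually_conj)
  \<comment> \<open>Below r the increment \<open>g t - g0\<close> is less than 1, too small for
    \<open>1 \<le> t * D t\<close>.\<close>
  then obtain r where r: "0 < r" "r < b" "g r < g0 + 1"
    using eventually_happens'[OF trivial_limit_at_right_real] by blast
  \<comment> \<open>The factor 2 is that of the quasi-minimal slopes; the summand t makes the
    derivative positive even where D vanishes.\<close>
  define p where "p t = 2 * (g t - g0) + t" for t
  \<comment> \<open>Continuing along the tangent at r keeps the derivative continuous and
    nonincreasing on the whole half-line.\<close>
  define h where "h t = p r + (2 * D r + 1) * (t - r)" for t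
  \<comment> \<open>The value at 0 is prescribed separately since g is controlled only to the right
    of 0.\<close>
  define \<phi> where "\<phi> t = (if t \<le> 0 then 0 else if t \<le> r then p t else h t)" for t
  define \<phi>' where "\<phi>' t = 2 * D (min t r) + 1" for t
  have p_deriv: "(p has_real_derivative 2 * D t + 1) (at t)" if "0 < t" "t < b" for t
    unfolding p_def by (auto intro!: derivative_eq_intros deriv that)
  have h_deriv: "(h has_real_derivative 2 * D r + 1) (at t)" for t
    unfolding h_def by (auto intro!: derivative_eq_intros)
  have glued: "((\<lambda>t. if t \<le> r then p t else h t) has_real_derivative \<phi>' t) (at t)" if t: "0 < t" for t
  proof -
    consider "t < r" | "t = r" | "r < t" by linarith
    then show ?thesis
    proof cases
      case 1
      have "((\<lambda>t. if t \<le> r then p t else h t) has_real_derivative 2 * D t + 1) (at t)"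
      proof (rule has_field_derivative_transform_within_open[OF p_deriv])
        show "open {..<r}" "t \<in> {..<r}" "0 < t" "t < b" using 1 t r by auto
      qed auto
      then show ?thesis using 1 by (simp add: \<phi>'_def)
    next
      case 2
      then show ?thesis
        using has_real_derivative_glue[OF p_deriv[OF r(1,2)] h_deriv] by (simp add: \<phi>'_def h_def)
    next
      case 3
      have "((\<lambda>t. if t \<le> r then p t else h t) has_real_derivative 2 * D r + 1) (at t)"
      proof (rule has_field_derivative_transform_within_open[OF h_deriv])
        show "open {r<..}" "t \<in> {r<..}" using 3 by auto
      qed auto
      then show ?thesis using 3 by (simp add: \<phi>'_def)
    qed
  qed
  have \<phi>_deriv: "(\<phi> has_real_derivative \<phi>' t) (at t)" if t: "0 < t" for t
  proof (rule has_field_derivative_transform_within_open[OF glued[OF t]])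
    show "open {0::real<..}" "t \<in> {0<..}" using t by auto
  qed (auto simp: \<phi>_def)
  show ?thesis
  proof (rule desingularizer_conclusion[where \<phi>=\<phi> and \<phi>'=\<phi>' and \<rho>=r])
    show "\<phi> 0 = 0" by (simp add: \<phi>_def)
    show "continuous_on {0..} \<phi>"
      unfolding continuous_on_def
    proof
      fix t :: real assume "t \<in> {0..}"
      show "(\<phi> \<longlongrightarrow> \<phi> t) (at t within {0..})"
      proof (cases "t = 0")
        case True
        have "((\<lambda>t. 2 * (g t - g0) + t) \<longlongrightarrow> 2 * (g0 - g0) + 0) (at_right 0)"
          by (intro tendsto_intros lim)
        then have "(p \<longlongrightarrow> 0) (at_right 0)" by (simp add: p_def[abs_def])
        moreover have "\<forall>\<^sub>F t in at_right 0. p t = \<phi> t"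
          unfolding eventually_at_right_field \<phi>_def using r(1) by (intro exI[of _ r]) auto
        ultimately have "(\<phi> \<longlongrightarrow> 0) (at_right 0)" by (rule Lim_transform_eventually)
        moreover have "at (0::real) within {0..} = at_right 0"
          by (auto simp: at_within_def intro!: arg_cong[of _ _ "\<lambda>A. inf (nhds 0) (principal A)"])
        ultimately show ?thesis using True by (simp add: \<phi>_def)
      next
        case False
        then have "isCont \<phi> t" using \<open>t \<in> {0..}\<close> by (intro DERIV_isCont[OF \<phi>_deriv]) auto
        then show ?thesis by (simp add: isCont_def tendsto_within_subset[of _ _ t UNIV])
      qed
    qed
    have "continuous_on {0<..} (\<lambda>t. D (min t r))"
      using r by (intro continuous_on_compose2[OF cont] continuous_intros) auto
    then show "continuous_on {0<..} \<phi>'" unfolding \<phi>'_def by (intro continuous_intros)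
    show "0 < \<phi>' t" if "0 < t" for t
      using Dnonneg[of "min t r"] that r by (simp add: \<phi>'_def min_less_iff_disj)
    show "\<phi>' t \<le> \<phi>' s" if "0 < s" "s \<le> t" for s t
      using anti'[of "min s r" "min t r"] that r by (simp add: \<phi>'_def min_less_iff_disj min.coboundedI1)
    have "definable_term (\<lambda>e. p (e 0))" "definable_term (\<lambda>e. h (e 0))"
      unfolding p_def h_def by (intro definable_intros g)+
    then show "definable_term (\<lambda>e. \<phi> (e 0))"
      unfolding \<phi>_def by (intro definable_term_if definable_intros)
    fix t \<epsilon> assume t: "0 < t" "t < r" and \<epsilon>: "level_slope_bound n U f t \<epsilon>"
    have "t * D t \<le> g t - g0" using tD t r by auto
    also have "\<dots> \<le> g r - g0" using mono_onD[OF mono, of t r] t r by auto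
    also have "\<dots> < 1" using r by simp
    finally have "1 \<le> 2 * \<epsilon> * D t" using bound[of t \<epsilon>] \<epsilon> t r by auto
    moreover have "0 < \<epsilon>" using \<epsilon> unfolding level_slope_bound_def slope_bound_def by blast
    ultimately show "1 \<le> \<epsilon> * \<phi>' t" using t by (simp add: \<phi>'_def algebra_simps)
  qed (use \<phi>_deriv r in auto)
qed

lemma definable_desingularizer:
  assumes U: "U \<in> S n" and f: "definable_fun S n U f"
    and bounded: "\<And>x i. x \<in> U \<Longrightarrow> i < n \<Longrightarrow> \<bar>x ! i\<bar> \<le> m"
  shows "\<exists>\<phi> \<rho>. desingularizer \<phi> \<and> concave_on {0..} \<phi> \<and> definable_on_nonneg S \<phi> \<and> \<rho> > 0 \<and>
    (\<forall>x\<in>U. 0 < f x \<and> f x < \<rho> \<longrightarrow>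
      slope U (euclidean_dist n) (\<lambda>y. ereal (zero_ext \<phi> (f y))) x \<ge> 1)"
proof -
  have "definable (\<lambda>e. \<exists>\<epsilon>. level_slope_bound n U f (e 0) \<epsilon>)"
    by (intro definable_ex definable_slope_bound(3)[OF U f] definable_term_var)
  then show ?thesis
  proof (rule germ_right_cases[of _ 0])
    \<comment> \<open>Here no point at a small positive level has finite slope, so the identity
      serves as desingularizer.\<close>
    assume "\<forall>\<^sub>F t in at_right 0. \<not> (\<exists>\<epsilon>. level_slope_bound n U f t \<epsilon>)"
    then obtain \<rho> where "\<rho> > 0" "\<And>t \<epsilon>. 0 < t \<Longrightarrow> t < \<rho> \<Longrightarrow> \<not> level_slope_bound n U f t \<epsilon>"
      unfolding eventually_at_right_field by blast
    then show ?thesis by (intro linear_desingularizer[of 1 \<rho>]) auto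
  next
    assume "\<forall>\<^sub>F t in at_right 0. \<exists>\<epsilon>. level_slope_bound n U f t \<epsilon>"
    from level_curve[OF U f bounded this]
    obtain b g where g: "0 < b" "definable_term (\<lambda>e. g (e 0))" "mono_on {0<..<b} g"
      "\<And>t. 0 < t \<Longrightarrow> t < b \<Longrightarrow> - (real n * m) \<le> g t"
      "\<And>t D \<epsilon>. 0 < t \<Longrightarrow> t < b \<Longrightarrow> (g has_real_derivative D) (at t) \<Longrightarrow> level_slope_bound n U f t \<epsilon> \<Longrightarrow>
        1 \<le> t * D \<or> 1 \<le> 2 * \<epsilon> * D"
      by blast
    obtain c D where c: "0 < c" "c \<le> b"
      "\<And>x. x \<in> {0<..<c} \<Longrightarrow> (g has_real_derivative D x) (at x)"
      "continuous_on {0<..<c} D" "mono_on {0<..<c} D \<or> antimono_on {0<..<c} D"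
      using germ_C1[OF g(2,1,3)] by blast
    from c(5) show ?thesis
    proof
      assume D: "antimono_on {0<..<c} D"
      show ?thesis
      proof (rule concave_desingularizer[where m="- (real n * m)", OF g(2) c(1) _ _ _ c(4) D])
        show "mono_on {0<..<c} g" using g(3) c(2) by (intro mono_on_subset[OF g(3)]) auto
      qed (use g(4,5) c(2,3) in auto)
    next
      assume D: "mono_on {0<..<c} D"
      obtain r where r: "0 < r" "r < c" using dense c(1) by blast
      \<comment> \<open>As D increases, \<open>D r\<close> bounds it below r, and every slope bound
        on a small level is at least 1 / C. The maximum with 1 makes C positive, and
        \<open>t < 1 / C\<close> rules out \<open>1 \<le> t * D t\<close>.\<close>
      define C where "C = max 1 (2 * \<bar>D r\<bar>)"
      show ?thesis
      proof (rule linear_desingularizer[of C "min r (1 / C)"])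
        show "0 < C" by (simp add: C_def)
        then show "0 < min r (1 / C)" using r by simp
        fix t \<epsilon> assume t: "0 < t" "t < min r (1 / C)" and \<epsilon>: "level_slope_bound n U f t \<epsilon>"
        have "D t \<le> D r" using mono_onD[OF D, of t r] t r by auto
        then have DC: "2 * D t \<le> C" "D t \<le> C" by (auto simp: C_def)
        have tC: "t * C < 1" using t \<open>0 < C\<close> by (simp add: pos_less_divide_eq)
        have "t * D t \<le> t * C" using DC(2) t by simp
        then have "\<not> 1 \<le> t * D t" using tC by linarith
        then have "1 \<le> \<epsilon> * (2 * D t)" using g(5)[of t "D t" \<epsilon>] c(2,3) t r \<epsilon> by (auto simp: mult_ac)
        also have "\<dots> \<le> \<epsilon> * C"
          using \<epsilon> DC(1) unfolding level_slope_bound_def slope_bound_def by (intro mult_left_mono) auto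
        finally show "1 \<le> \<epsilon> * C" .
      qed
    qed
  qed
qed

end

lemma mbounded_imp_coordinates_bounded:
  assumes "Metric_space.mbounded (Rn n) (euclidean_dist n) U"
  obtains m where "\<And>x i. x \<in> U \<Longrightarrow> i < n \<Longrightarrow> \<bar>x ! i\<bar> \<le> m"
proof -
  interpret Metric_space "Rn n" "euclidean_dist n" by (rule Metric_space_euclidean_dist)
  obtain c B where cB: "U \<subseteq> mcball c B" using assms unfolding mbounded_def by blast
  have "\<bar>x ! i\<bar> \<le> B + (\<Sum>i<n. \<bar>c ! i\<bar>)" if "x \<in> U" "i < n" for x i
  proof -
    have "\<bar>c ! i - x ! i\<bar> \<le> euclidean_dist n c x"
      using member_le_L2_set[of "{..<n}" i "\<lambda>i. \<bar>c ! i - x ! i\<bar>"] that(2)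
      by (simp add: euclidean_dist_def L2_set_def)
    moreover have "euclidean_dist n c x \<le> B" using cB that(1) by auto
    moreover have "\<bar>c ! i\<bar> \<le> (\<Sum>i<n. \<bar>c ! i\<bar>)" using that(2) by (intro member_le_sum) auto
    ultimately show ?thesis by linarith
  qed
  then show ?thesis using that by blast
qed

theorem theorem4p3:
  fixes S :: "nat \<Rightarrow> real list set set"
    and n :: nat
    and U :: "real list set"
    and f :: "real list \<Rightarrow> real"
  assumes "o_minimal_real_field_expansion S"
    and "U \<in> S n"
    and "Metric_space.mbounded (Rn n) (euclidean_dist n) U"
    and "definable_fun S n U f"
  shows "\<exists>\<phi> \<rho>. desingularizer \<phi> \<and> concave_on {0..} \<phi> \<and> definable_on_nonneg S \<phi> \<and> \<rho> > 0 \<and>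
    (\<forall>x\<in>U. 0 < f x \<and> f x < \<rho> \<longrightarrow>
      slope U (euclidean_dist n) (\<lambda>y. ereal (zero_ext \<phi> (f y))) x \<ge> 1)"
proof -
  obtain m where "\<And>x i. x \<in> U \<Longrightarrow> i < n \<Longrightarrow> \<bar>x ! i\<bar> \<le> m"
    using mbounded_imp_coordinates_bounded[OF assms(3)] by blast
  with assms show ?thesis
    by (intro o_minimal_real_field_expansion.definable_desingularizer)
qed

end
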